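(* Let $\tilde\theta_i$ stand for any of the estimators $\tilde\theta_{H,i}$, $\tilde\theta_{S,i}$, or $\tilde\theta_{AS,i}$. Then for every $i\ge1$ satisfying $i\le k=k(n)$ for large enough $n$ we have the following: (a) $\tilde\theta_i$ is consistent for $\theta_i$ if and only if $\xi_{i,n}\eta_{i,n}\to0$ and $\xi_{i,n}/n^{1/2}\to0$. (b) Suppose $\xi_{i,n}\eta_{i,n}\to0$ and $\xi_{i,n}/n^{1/2}\to0$. Then $\tilde\theta_i$ is uniformly consistent in the sense that for every $\varepsilon>0$ $$\lim_{n\to\infty}\sup_{\theta\in\mathbb{R}^k}\sup_{0<\sigma<\infty}P_{n,\theta,\sigma}\left(|\tilde\theta_i-\theta_i|>\sigma\varepsilon\right)=0.$$ Furthermore, $\tilde\theta_i$ is uniformly $a_{i,n}$-consistent with $a_{i,n}=\min\left(n^{1/2}/\xi_{i,n},(\xi_{i,n}\eta_{i,n})^{-1}\right)$ in the sense that for every $\varepsilon>0$ there exists a real number $M>0$ such that $$\sup_{n\in\mathbb{N}}\sup_{\theta\in\mathbb{R}^k}\sup_{0<\sigma<\infty}P_{n,\theta,\sigma}\left(a_{i,n}|\tilde\theta_i-\theta_i|>\sigma M\right)<\varepsilon.$$ (c) Suppose $\xi_{i,n}\eta_{i,n}\to0$ and $\xi_{i,n}/n^{1/2}\to0$ and $b_{i,n}\ge0$. If for every $\varepsilon>0$ there exists a real number $M>0$ such that $$\limsup_{n\to\infty}\sup_{\theta\in\mathbb{R}^k}\sup_{0<\sigma<\infty}P_{n,\theta,\sigma}\left(b_{i,n}|\tilde\theta_i-\theta_i|>\sigma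 M\right)<\varepsilon$$ holds, then $b_{i,n}=O(a_{i,n})$ necessarily holds. (d) Let $\hat\theta_i$ stand for any of the estimators $\hat\theta_{H,i}$, $\hat\theta_{S,i}$, or $\hat\theta_{AS,i}$. Then the results in (a)-(c) also hold for $\hat\theta_i$ (in place of $\tilde\theta_i$).
   Context: For each sample size $n$ consider the linear regression model $Y=X\theta+u$, where $X$ is a nonstochastic $n\times k$ matrix of rank $k\ge1$, $\theta\in\mathbb{R}^k$, $u\sim N(0,\sigma^2I_n)$, $0<\sigma<\infty$. The number $k=k(n)$, the entries of $X,Y,u$ and the underlying probability space may depend on $n$. $P_{n,\theta,\sigma}$ denotes probability under parameters $\theta,\sigma$. $X'$ is the transpose of $X$. $\xi_{i,n}$ is the nonnegative square root of the $i$-th diagonal element of $(X'X/n)^{-1}$. $\hat\theta_{LS}=(X'X)^{-1}X'Y$ with $i$-th component $\hat\theta_{LS,i}$, and $\hat\sigma^2=(n-k)^{-1}(Y-X\hat\theta_{LS})'(Y-X\hat\theta_{LS})$, $\hat\sigma\ge0$. The tuning parameters $\eta_{i,n}$ are positive real numbers. For the feasible estimators (tilde) $n>k$ is assumed; for the infeasible ones (hat) $n\ge k$ suffices. Expressions involving index $i$ are considered only for those $n$ with $i\le k(n)$. Feasible thresholding estimators: $\tilde\theta_{H,i}=\hat\theta_{LS,i}\mathbf{1}(|\hat\theta_{LS,i}|>\hat\sigma\xi_{i,n}\eta_{i,n})$; $\tilde\theta_{S,i}=\mathrm{sign}(\hat\theta_{LS,i})(|\hat\theta_{LS,i}|-\hat\sigma\xi_{i,n}\eta_{i,n})_+$;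 $\tilde\theta_{AS,i}=\hat\theta_{LS,i}(1-\hat\sigma^2\xi_{i,n}^2\eta_{i,n}^2/\hat\theta_{LS,i}^2)_+$ (equal to $0$ if $|\hat\theta_{LS,i}|\le\hat\sigma\xi_{i,n}\eta_{i,n}$). Here $(\cdot)_+=\max(\cdot,0)$. The infeasible versions $\hat\theta_{H,i},\hat\theta_{S,i},\hat\theta_{AS,i}$ are defined by the same formulas with $\hat\sigma$ replaced by $\sigma$. Consistency of an estimator for $\theta_i$ (part (a)) means convergence in $P_{n,\theta,\sigma}$-probability to $\theta_i$ as $n\to\infty$ for every fixed value of $\theta_i\in\mathbb{R}$ and $\sigma\in(0,\infty)$ (not depending on $n$). Standing assumption for all asymptotics: $\sup_n\xi_{j,n}^2/n<\infty$ for every fixed $j\ge1$ satisfying $j\le k(n)$ for large enough $n$. *)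

theory Defs
  imports
    "HOL-Probability.Probability"
    "HOL-Library.Landau_Symbols"
    "Jordan_Normal_Form.Gauss_Jordan_Elimination"
    "Jordan_Normal_Form.DL_Rank"
begin

unbundle no vec_syntax and no inner_syntax

text \<open>Matrices and vectors have sizes given by natural numbers, and their indices start at 0.
  Hence the component of index \<open>i\<close> here is the mathematical component number \<open>i + 1\<close>, and
  the admissible indices are those with \<open>i < k\<close>.\<close>

definition inv_mat :: "real mat \<Rightarrow> real mat" where
  "inv_mat A = the (mat_inverse A)"

text \<open>The model \<open>Y = X \<theta> + u\<close> with \<open>u \<sim> N(0, \<sigma>\<^sup>2 I\<^sub>n)\<close>: the errors \<open>u = Y - X \<theta>\<close> have independent
  components with law \<open>N(0, \<sigma>\<^sup>2)\<close>. The second parameter of \<^const>\<open>normal_density\<close> is the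
  standard deviation.\<close>

definition gaussian_regression ::
  "nat \<Rightarrow> nat \<Rightarrow> real mat \<Rightarrow> ('a \<Rightarrow> real vec) \<Rightarrow> (real vec \<Rightarrow> real \<Rightarrow> 'a measure) \<Rightarrow> bool" where
  "gaussian_regression n k X Y P \<longleftrightarrow>
     1 \<le> k \<and> X \<in> carrier_mat n k \<and> vec_space.rank n X = k \<and>
     (\<forall>\<theta>\<in>carrier_vec k. \<forall>\<sigma>>0.
        prob_space (P \<theta> \<sigma>) \<and>
        (\<forall>\<omega>\<in>space (P \<theta> \<sigma>). Y \<omega> \<in> carrier_vec n) \<and>
        prob_space.indep_vars (P \<theta> \<sigma>) (\<lambda>_. borel) (\<lambda>r \<omega>. (Y \<omega> - X *\<^sub>v \<theta>) $ r) {..<n} \<and>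
        (\<forall>r<n. distributed (P \<theta> \<sigma>) lborel (\<lambda>\<omega>. (Y \<omega> - X *\<^sub>v \<theta>) $ r) (normal_density 0 \<sigma>)))"

definition xi :: "real mat \<Rightarrow> nat \<Rightarrow> real" where
  "xi X i = sqrt (inv_mat ((1 / real (dim_row X)) \<cdot>\<^sub>m (transpose_mat X * X)) $$ (i, i))"

definition theta_LS :: "real mat \<Rightarrow> real vec \<Rightarrow> real vec" where
  "theta_LS X y = inv_mat (transpose_mat X * X) *\<^sub>v (transpose_mat X *\<^sub>v y)"

definition sigma_hat :: "real mat \<Rightarrow> real vec \<Rightarrow> real" where
  "sigma_hat X y =
     (let r = y - X *\<^sub>v theta_LS X y
      in sqrt ((r \<bullet> r) / (real (dim_row X) - real (dim_col X))))"

text \<open>Thresholding rules, applied to a value \<open>x\<close> with threshold \<open>t\<close>.\<close>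

definition hard_thr :: "real \<Rightarrow> real \<Rightarrow> real" where
  "hard_thr x t = (if \<bar>x\<bar> > t then x else 0)"

definition soft_thr :: "real \<Rightarrow> real \<Rightarrow> real" where
  "soft_thr x t = sgn x * max (\<bar>x\<bar> - t) 0"

definition adaptive_soft_thr :: "real \<Rightarrow> real \<Rightarrow> real" where
  "adaptive_soft_thr x t = x * max (1 - t\<^sup>2 / x\<^sup>2) 0"

text \<open>The argument \<open>h\<close> is the value of the tuning parameter. The feasible estimator ignores \<open>\<sigma>\<close>;
  it is an argument only so that both kinds of estimator have the same type.\<close>

definition feasible_est ::
  "(real \<Rightarrow> real \<Rightarrow> real) \<Rightarrow> real mat \<Rightarrow> nat \<Rightarrow> real \<Rightarrow> real \<Rightarrow> real vec \<Rightarrow> real" where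
  "feasible_est T X i h \<sigma> y = T (theta_LS X y $ i) (sigma_hat X y * xi X i * h)"

definition infeasible_est ::
  "(real \<Rightarrow> real \<Rightarrow> real) \<Rightarrow> real mat \<Rightarrow> nat \<Rightarrow> real \<Rightarrow> real \<Rightarrow> real vec \<Rightarrow> real" where
  "infeasible_est T X i h \<sigma> y = T (theta_LS X y $ i) (\<sigma> * xi X i * h)"

text \<open>Below, \<open>est n \<sigma> \<omega>\<close> is the value of the estimator of \<open>\<theta>\<^sub>i\<close> at sample size \<open>n\<close>.
  In the notion of consistency, \<open>\<sigma>\<close> and the component of interest are held fixed, whereas the
  other components of the parameter (whose dimension \<open>k n\<close> depends on \<open>n\<close>) may vary freely.\<close>

definition consistent ::
  "(nat \<Rightarrow> real vec \<Rightarrow> real \<Rightarrow> 'a measure) \<Rightarrow> (nat \<Rightarrow> nat) \<Rightarrow> nat \<Rightarrow> (nat \<Rightarrow> real \<Rightarrow> 'a \<Rightarrow> real) \<Rightarrow> bool" where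
  "consistent P k i est \<longleftrightarrow>
     (\<forall>t. \<forall>\<sigma>>0. \<forall>\<theta>.
        (\<forall>n. \<theta> n \<in> carrier_vec (k n) \<and> (i < k n \<longrightarrow> \<theta> n $ i = t)) \<longrightarrow>
        (\<forall>\<epsilon>>0. (\<lambda>n. \<P>(\<omega> in P n (\<theta> n) \<sigma>. \<bar>est n \<sigma> \<omega> - t\<bar> > \<epsilon>)) \<longlonglongrightarrow> 0))"

text \<open>The supremum over all \<open>\<theta>\<close> and all \<open>\<sigma> > 0\<close> of the probability that
  \<open>c \<bar>est - \<theta>\<^sub>i\<bar> > \<sigma> M\<close>, at one sample size.\<close>

definition sup_prob ::
  "(real vec \<Rightarrow> real \<Rightarrow> 'a measure) \<Rightarrow> nat \<Rightarrow> nat \<Rightarrow> (real \<Rightarrow> 'a \<Rightarrow> real) \<Rightarrow> real \<Rightarrow> real \<Rightarrow> real" where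
  "sup_prob P k i est c M =
     (SUP \<theta>\<in>carrier_vec k. SUP \<sigma>\<in>{0<..}. \<P>(\<omega> in P \<theta> \<sigma>. c * \<bar>est \<sigma> \<omega> - \<theta> $ i\<bar> > \<sigma> * M))"

definition rate :: "real mat \<Rightarrow> nat \<Rightarrow> real \<Rightarrow> real" where
  "rate X i h = min (sqrt (real (dim_row X)) / xi X i) (1 / (xi X i * h))"

end

theory Submission
  imports Defs
begin

text \<open>With \<open>u = Y - X \<theta>\<close>, the least squares component is \<open>\<theta>\<^sub>i + N(u)\<close>, where \<open>N\<close> is linear and
  \<open>N(u)\<close> is centred normal with standard deviation \<open>\<sigma> s\<close>, \<open>s = \<xi> / \<surd>n\<close>. The threshold is \<open>W(u) v\<close>
  with \<open>v = \<xi> \<eta>\<close>, where \<open>W\<close> is \<open>\<sigma>\<close> in the infeasible case and the residual standard error, again a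
  function of \<open>u\<close> alone, in the feasible case. Both cases are treated together, because only two
  facts about \<open>W\<close> matter: its second moment is \<open>\<sigma>\<^sup>2\<close>, and it is at least \<open>\<sigma> / 2\<close> with a probability
  bounded away from 0, whatever the number of degrees of freedom. Two estimates at a fixed sample
  size then give the whole theorem.

  Upper estimate (\<open>error_tail_bound\<close>). Each of the rules moves its argument by at most the
  threshold, so the error of the estimator is at most \<open>\<bar>N\<bar> + W v\<close>. By Chebyshev's inequality, the
  probability that the \<open>c\<close>-fold error exceeds \<open>\<sigma> M\<close> is at most \<open>2 c\<^sup>2 (s\<^sup>2 + v\<^sup>2) / M\<^sup>2\<close>, uniformly
  in \<open>\<theta>\<close> and \<open>\<sigma>\<close>. With fixed \<open>c\<close> this gives consistency and uniform consistency; with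
  \<open>c = min (1/s) (1/v)\<close>, it gives the rate.

  Lower estimate (\<open>accuracy_bounds_scales\<close>). Suppose that the estimator has error at most \<open>e < t\<close>
  with high probability, both under \<open>\<theta>\<^sub>i = t\<close> and under \<open>\<theta>\<^sub>i = -t\<close>. The law of \<open>u\<close> does not depend
  on \<open>\<theta>\<close>, so both situations can be realised with the same errors. Since the rules are odd, and
  expand distances above the threshold, accuracy at \<open>t\<close> and \<open>-t\<close> with the same errors forces
  \<open>\<bar>N\<bar> \<le> e\<close> and \<open>W v < t\<close>. The first is improbable unless \<open>s\<close> is of order \<open>e\<close>, because the density of
  \<open>N\<close> is at most \<open>1 / (2 s)\<close>; the second is improbable unless \<open>v\<close> is of order \<open>t\<close>, because \<open>W\<close> is
  not small. Taking \<open>t\<close> fixed and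
  small shows that consistency forces \<open>s\<close> and \<open>v\<close> to vanish; taking \<open>t = 2 M / b\<close> and \<open>e = M / b\<close>
  shows that no rate \<open>b\<close> can exceed the order of \<open>min (1/s) (1/v)\<close>.\<close>

section \<open>Thresholding rules\<close>

lemma thresholding_error_le:
  assumes "T \<in> {hard_thr, soft_thr, adaptive_soft_thr}" and "0 \<le> \<tau>"
  shows "\<bar>T x \<tau> - x\<bar> \<le> \<tau>"
proof -
  have "\<bar>adaptive_soft_thr x \<tau> - x\<bar> \<le> \<tau>"
  proof (cases "\<bar>x\<bar> > \<tau>")
    case True
    then have x: "x \<noteq> 0" and sq: "\<tau>\<^sup>2 \<le> x\<^sup>2"
      using \<open>0 \<le> \<tau>\<close> by (auto simp: abs_le_square_iff[symmetric])
    have "0 \<le> 1 - \<tau>\<^sup>2 / x\<^sup>2" using x sq by (simp add: field_simps)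
    then have "adaptive_soft_thr x \<tau> - x = - (\<tau> * (\<tau> / x))"
      using x by (simp add: adaptive_soft_thr_def max_absorb1 field_simps power2_eq_square)
    moreover have "\<tau> * \<bar>\<tau> / x\<bar> \<le> \<tau> * 1"
      using True x \<open>0 \<le> \<tau>\<close> by (intro mult_left_mono) (auto simp: abs_divide)
    ultimately show ?thesis using \<open>0 \<le> \<tau>\<close> by (simp add: abs_mult)
  next
    case False
    then have "x\<^sup>2 \<le> \<tau>\<^sup>2" using \<open>0 \<le> \<tau>\<close> by (auto simp: abs_le_square_iff[symmetric])
    then have "adaptive_soft_thr x \<tau> = 0"
      by (cases "x = 0") (auto simp: adaptive_soft_thr_def max_def field_simps)
    then show ?thesis using False by simp
  qed
  then show ?thesis
    using assms by (auto simp: hard_thr_def soft_thr_def max_def sgn_if abs_if)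
qed

lemma thresholding_minus:
  assumes "T \<in> {hard_thr, soft_thr, adaptive_soft_thr}"
  shows "T (- x) \<tau> = - T x \<tau>"
  using assms by (auto simp: hard_thr_def soft_thr_def adaptive_soft_thr_def sgn_if)

lemma thresholding_pos_imp_above:
  assumes "T \<in> {hard_thr, soft_thr, adaptive_soft_thr}" and "0 \<le> \<tau>" and "0 < T x \<tau>"
  shows "\<tau> < x"
proof -
  have "\<tau> < x" if "0 < adaptive_soft_thr x \<tau>"
  proof -
    have "0 < x" "0 < 1 - \<tau>\<^sup>2 / x\<^sup>2"
      using that by (auto simp: adaptive_soft_thr_def zero_less_mult_iff max_def split: if_splits)
    then have "\<tau>\<^sup>2 < x\<^sup>2" by (simp add: field_simps)
    then show ?thesis using \<open>0 < x\<close> by (intro power_less_imp_less_base[of \<tau> 2 x]) auto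
  qed
  then show ?thesis
    using assms by (auto simp: hard_thr_def soft_thr_def max_def sgn_if zero_less_mult_iff split: if_splits)
qed

text \<open>Above the threshold the three rules are \<open>x\<close>, \<open>x - \<tau>\<close> and \<open>x - \<tau>\<^sup>2 / x\<close>, all of slope at least 1.\<close>
lemma thresholding_expanding:
  assumes "T \<in> {hard_thr, soft_thr, adaptive_soft_thr}" and "0 \<le> \<tau>" and "\<tau> < x" and "x \<le> y"
  shows "y - x \<le> T y \<tau> - T x \<tau>"
proof -
  have "0 < x" using assms by simp
  have as: "adaptive_soft_thr z \<tau> = z - \<tau>\<^sup>2 / z" if "z > \<tau>" for z
  proof -
    have "0 < z" "\<tau>\<^sup>2 \<le> z\<^sup>2" using that assms by (auto intro: power_mono)
    then have "0 < z" "0 \<le> 1 - \<tau>\<^sup>2 / z\<^sup>2" by (simp_all add: field_simps)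
    then show ?thesis by (simp add: adaptive_soft_thr_def max_absorb1 field_simps power2_eq_square)
  qed
  have "\<tau>\<^sup>2 / y \<le> \<tau>\<^sup>2 / x" using \<open>0 < x\<close> assms by (intro divide_left_mono) auto
  then have "y - x \<le> adaptive_soft_thr y \<tau> - adaptive_soft_thr x \<tau>"
    using assms by (simp add: as)
  then show ?thesis
    using assms by (auto simp: hard_thr_def soft_thr_def)
qed

text \<open>The key deterministic fact. By oddness, accuracy at \<open>- t + v\<close> means accuracy at \<open>t - v\<close>. Thus
  \<open>t + v\<close> and \<open>t - v\<close>, at distance \<open>2 \<bar>v\<bar>\<close>, are both mapped into an interval of length \<open>2 e\<close>
  around \<open>t\<close>. That interval is positive, so both lie above the threshold, where the rules expand.\<close>
lemma two_sided_accuracy: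
  assumes T: "T \<in> {hard_thr, soft_thr, adaptive_soft_thr}" and "0 \<le> \<tau>" and "e < t"
    and plus: "\<bar>T (t + v) \<tau> - t\<bar> \<le> e" and minus: "\<bar>T (- t + v) \<tau> - (- t)\<bar> \<le> e"
  shows "\<bar>v\<bar> \<le> e \<and> \<tau> < t"
proof -
  have minus': "\<bar>T (t - v) \<tau> - t\<bar> \<le> e"
    using minus thresholding_minus[OF T, of "t - v" \<tau>] by (simp add: algebra_simps)
  have "0 < T (t + v) \<tau>" "0 < T (t - v) \<tau>"
    using plus minus' \<open>e < t\<close> by auto
  then have above: "\<tau> < t + v" "\<tau> < t - v"
    using thresholding_pos_imp_above[OF T \<open>0 \<le> \<tau>\<close>] by blast+
  then have "\<bar>v\<bar> + \<bar>v\<bar> \<le> e + e"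
    using thresholding_expanding[OF T \<open>0 \<le> \<tau>\<close>, of "t - v" "t + v"]
      thresholding_expanding[OF T \<open>0 \<le> \<tau>\<close>, of "t + v" "t - v"] plus minus'
    by (cases "0 \<le> v") auto
  then show ?thesis using above by simp
qed

lemma thresholding_measurable:
  assumes "T \<in> {hard_thr, soft_thr, adaptive_soft_thr}"
    and [measurable]: "f \<in> borel_measurable M" "g \<in> borel_measurable M"
  shows "(\<lambda>\<omega>. T (f \<omega>) (g \<omega>)) \<in> borel_measurable M"
proof -
  have s: "sgn (x::real) = indicator {0<..} x - indicator {..<0} x" for x
    by (auto simp: sgn_if)
  have "(\<lambda>\<omega>. hard_thr (f \<omega>) (g \<omega>)) \<in> borel_measurable M"
    unfolding hard_thr_def by measurable
  moreover have "(\<lambda>\<omega>. soft_thr (f \<omega>) (g \<omega>)) \<in> borel_measurable M"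
    unfolding soft_thr_def s by measurable
  moreover have "(\<lambda>\<omega>. adaptive_soft_thr (f \<omega>) (g \<omega>)) \<in> borel_measurable M"
    unfolding adaptive_soft_thr_def by measurable
  ultimately show ?thesis using assms(1) by auto
qed

section \<open>Linear algebra of least squares\<close>

lemma full_column_rank_injective:
  fixes X :: "real mat"
  assumes X: "X \<in> carrier_mat n k" and rank: "vec_space.rank n X = k"
    and v: "v \<in> carrier_vec k" and "X *\<^sub>v v = 0\<^sub>v n"
  shows "v = 0\<^sub>v k"
proof -
  interpret vec_space "TYPE(real)" n .
  have distinct: "distinct (cols X)"
  proof (rule ccontr)
    assume "\<not> distinct (cols X)"
    then have card: "card (set (cols X)) < k"
      using X card_length[of "cols X"] card_distinct[of "cols X"] by fastforce
    have "rank X \<le> card (set (cols X))"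
    proof -
      have "lin_indpt {}" using fin_dim finite_basis_exists subset_li_is_li vec_vs basis_def
        by (metis empty_subsetI)
      \<comment> \<open>The rank is the size of a maximal independent set of columns.\<close>
      then obtain S where S: "maximal S (\<lambda>T. T \<subseteq> set (cols X) \<and> lin_indpt T)"
        using maximal_exists_superset[of "set (cols X)" "\<lambda>T. T \<subseteq> set (cols X) \<and> lin_indpt T" "{}"]
        by auto
      then have "S \<subseteq> set (cols X)" by (simp add: maximal_def)
      then show ?thesis
        using rank_card_indpt[OF X S] by (simp add: card_mono)
    qed
    then show False using card rank by simp
  qed
  show ?thesis
    using lin_depI[OF X v _ \<open>X *\<^sub>v v = 0\<^sub>v n\<close> distinct] full_rank_lin_indpt[OF X rank distinct] by blast
qed

lemma inv_mat_eqI: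
  assumes A: "A \<in> carrier_mat k k" and B: "B \<in> carrier_mat k k"
    and AB: "A * B = 1\<^sub>m k" and BA: "B * A = 1\<^sub>m k"
  shows "inv_mat A = B"
proof -
  have "A \<in> Units (ring_mat TYPE(real) k ())"
    unfolding Units_def using A B AB BA by (auto simp: ring_mat_def)
  then obtain B' where B': "mat_inverse A = Some B'"
    using mat_inverse(1)[OF A, where b = "()"] by (cases "mat_inverse A") auto
  then have inv: "B' * A = 1\<^sub>m k" "B' \<in> carrier_mat k k" using mat_inverse(2)[OF A] by auto
  have "B' = B' * (A * B)" using inv AB by simp
  also have "\<dots> = B" using inv A B by (simp flip: assoc_mult_mat[of B' k k A k B k])
  finally show ?thesis using B' by (simp add: inv_mat_def)
qed

lemma gram_inverse:
  fixes X :: "real mat"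
  assumes X: "X \<in> carrier_mat n k" and rank: "vec_space.rank n X = k"
  shows "inv_mat (transpose_mat X * X) \<in> carrier_mat k k"
    and "transpose_mat X * X * inv_mat (transpose_mat X * X) = 1\<^sub>m k"
    and "inv_mat (transpose_mat X * X) * (transpose_mat X * X) = 1\<^sub>m k"
proof -
  define A where "A = transpose_mat X * X"
  have A: "A \<in> carrier_mat k k" unfolding A_def using X by simp
  have "det A \<noteq> 0"
  proof
    assume "det A = 0"
    then obtain v where v: "v \<in> carrier_vec k" "v \<noteq> 0\<^sub>v k" and zero: "A *\<^sub>v v = 0\<^sub>v k"
      using det_0_iff_vec_prod_zero_field[OF A] by blast
    have Xv: "X *\<^sub>v v \<in> carrier_vec n" using X v by simp
    \<comment> \<open>A vector in the kernel of the Gram matrix lies in the kernel of \<open>X\<close>.\<close>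
    have "(X *\<^sub>v v) \<bullet> (X *\<^sub>v v) = v \<bullet> (A *\<^sub>v v)"
      using X v Xv
      by (simp add: A_def assoc_mult_mat_vec[of "transpose_mat X" k n X k v]
          comm_scalar_prod[of v k] transpose_vec_mult_scalar[of X n k v "X *\<^sub>v v"])
    then have "(X *\<^sub>v v) \<bullet> (X *\<^sub>v v) = 0" using zero v by simp
    then have "(\<Sum>j<n. (X *\<^sub>v v) $ j * (X *\<^sub>v v) $ j) = 0"
      using X by (simp add: scalar_prod_def lessThan_atLeast0)
    then have "X *\<^sub>v v = 0\<^sub>v n"
      using Xv X by (intro eq_vecI) (auto simp: sum_nonneg_eq_0_iff)
    then show False using full_column_rank_injective[OF X rank v(1)] v(2) by blast
  qed
  then have "A \<in> Units (ring_mat TYPE(real) k ())" by (rule det_non_zero_imp_unit[OF A])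
  then obtain B where B: "mat_inverse A = Some B"
    using mat_inverse(1)[OF A, where b = "()"] by (cases "mat_inverse A") auto
  show "inv_mat (transpose_mat X * X) \<in> carrier_mat k k"
    and "transpose_mat X * X * inv_mat (transpose_mat X * X) = 1\<^sub>m k"
    and "inv_mat (transpose_mat X * X) * (transpose_mat X * X) = 1\<^sub>m k"
    using mat_inverse(2)[OF A B] B unfolding A_def[symmetric] by (auto simp: inv_mat_def)
qed

definition ls_mat :: "real mat \<Rightarrow> real mat" where
  "ls_mat X = inv_mat (transpose_mat X * X) * transpose_mat X"

definition resid_mat :: "real mat \<Rightarrow> real mat" where
  "resid_mat X = 1\<^sub>m (dim_row X) - X * ls_mat X"

context
  fixes X :: "real mat" and n k :: nat
  assumes X: "X \<in> carrier_mat n k" and rank: "vec_space.rank n X = k"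
begin

lemma ls_mat_carrier: "ls_mat X \<in> carrier_mat k n"
  unfolding ls_mat_def using gram_inverse(1)[OF X rank] X by simp

lemma ls_mat_left_inverse: "ls_mat X * X = 1\<^sub>m k"
  unfolding ls_mat_def using gram_inverse(1,3)[OF X rank] X
  by (simp add: assoc_mult_mat[of _ k k "transpose_mat X" n X k])

text \<open>The \<open>(i, i)\<close> entry is the variance factor of the \<open>i\<close>-th least squares component, which links
  \<open>xi\<close> to the coefficients of that component. The transpose of the inverse comes from the right-hand
  factor of the product.\<close>
lemma ls_mat_gram: "ls_mat X * transpose_mat (ls_mat X) = transpose_mat (inv_mat (transpose_mat X * X))"
proof -
  define B where "B = inv_mat (transpose_mat X * X)"
  have B: "B \<in> carrier_mat k k" unfolding B_def by (rule gram_inverse(1)[OF X rank])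
  have "ls_mat X * transpose_mat (ls_mat X) = ls_mat X * (X * transpose_mat B)"
    unfolding ls_mat_def B_def[symmetric] using X B by (simp add: transpose_mult[of B k k _ n])
  also have "\<dots> = (ls_mat X * X) * transpose_mat B"
    using ls_mat_carrier X B by (simp add: assoc_mult_mat[of _ k n X k _ k])
  also have "\<dots> = transpose_mat B" using B by (simp add: ls_mat_left_inverse)
  finally show ?thesis by (simp add: B_def)
qed

lemma xi_eq:
  assumes "1 \<le> n" "i < k"
  shows "xi X i = sqrt (real n * (\<Sum>r<n. (ls_mat X $$ (i, r))\<^sup>2))"
proof -
  define A where "A = transpose_mat X * X"
  define B where "B = inv_mat A"
  have A: "A \<in> carrier_mat k k" unfolding A_def using X by simp
  have B: "B \<in> carrier_mat k k" "A * B = 1\<^sub>m k" "B * A = 1\<^sub>m k"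
    unfolding B_def A_def using gram_inverse[OF X rank] by auto
  have "inv_mat ((1 / real n) \<cdot>\<^sub>m A) = real n \<cdot>\<^sub>m B"
  proof (rule inv_mat_eqI)
    have 1: "a \<cdot>\<^sub>m U * (b \<cdot>\<^sub>m V) = (a * b) \<cdot>\<^sub>m (U * V)"
      if "U \<in> carrier_mat k k" "V \<in> carrier_mat k k" for a b :: real and U V
      using that by (intro eq_matI) (auto simp: scalar_prod_def sum_distrib_left ac_simps)
    show "(1 / real n) \<cdot>\<^sub>m A * (real n \<cdot>\<^sub>m B) = 1\<^sub>m k" "real n \<cdot>\<^sub>m B * ((1 / real n) \<cdot>\<^sub>m A) = 1\<^sub>m k"
      using assms A B by (auto simp: 1)
  qed (use A B in auto)
  moreover have "B $$ (i, i) = (ls_mat X * transpose_mat (ls_mat X)) $$ (i, i)"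
    using B assms by (simp add: ls_mat_gram B_def A_def)
  then have "B $$ (i, i) = (\<Sum>r<n. (ls_mat X $$ (i, r))\<^sup>2)"
    using ls_mat_carrier assms by (simp add: scalar_prod_def lessThan_atLeast0 power2_eq_square)
  ultimately show ?thesis
    using X B assms unfolding xi_def A_def[symmetric] by simp
qed

text \<open>A vanishing row would contradict that \<open>ls_mat X\<close> is a left inverse of \<open>X\<close>.\<close>
lemma ls_row_nonzero:
  assumes "i < k"
  shows "0 < (\<Sum>r<n. (ls_mat X $$ (i, r))\<^sup>2)"
proof (rule ccontr)
  assume "\<not> 0 < (\<Sum>r<n. (ls_mat X $$ (i, r))\<^sup>2)"
  then have "(\<Sum>r<n. (ls_mat X $$ (i, r))\<^sup>2) = 0"
    using sum_nonneg[of "{..<n}" "\<lambda>r. (ls_mat X $$ (i, r))\<^sup>2"] by auto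
  then have zero: "\<forall>r<n. ls_mat X $$ (i, r) = 0" by (simp add: sum_nonneg_eq_0_iff)
  have "(ls_mat X * X) $$ (i, i) = 0"
    using ls_mat_carrier X assms zero by (simp add: scalar_prod_def)
  then show False using assms by (simp add: ls_mat_left_inverse)
qed

lemma theta_LS_decomp:
  assumes y: "y \<in> carrier_vec n" and \<theta>: "\<theta> \<in> carrier_vec k"
  shows "theta_LS X y = \<theta> + ls_mat X *\<^sub>v (y - X *\<^sub>v \<theta>)"
proof -
  have "theta_LS X y = ls_mat X *\<^sub>v y"
    unfolding theta_LS_def ls_mat_def using gram_inverse(1)[OF X rank] X y
    by (simp add: assoc_mult_mat_vec[of _ k k _ n])
  also have "\<dots> = ls_mat X *\<^sub>v (X *\<^sub>v \<theta> + (y - X *\<^sub>v \<theta>))"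
    using X y \<theta> by (intro arg_cong[of y _ "(*\<^sub>v) (ls_mat X)"] eq_vecI) auto
  also have "\<dots> = ls_mat X *\<^sub>v (X *\<^sub>v \<theta>) + ls_mat X *\<^sub>v (y - X *\<^sub>v \<theta>)"
    using ls_mat_carrier X y \<theta> by (intro mult_add_distrib_mat_vec[of _ k n]) auto
  also have "ls_mat X *\<^sub>v (X *\<^sub>v \<theta>) = \<theta>"
    using ls_mat_carrier X \<theta> by (simp add: ls_mat_left_inverse flip: assoc_mult_mat_vec[of _ k n X k])
  finally show ?thesis .
qed

text \<open>The residual does not see the parameter, because \<open>resid_mat X\<close> annihilates the columns of
  \<open>X\<close>.\<close>
lemma residual_eq:
  assumes y: "y \<in> carrier_vec n" and \<theta>: "\<theta> \<in> carrier_vec k"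
  shows "y - X *\<^sub>v theta_LS X y = resid_mat X *\<^sub>v (y - X *\<^sub>v \<theta>)"
proof -
  define u where "u = y - X *\<^sub>v \<theta>"
  have u: "u \<in> carrier_vec n" unfolding u_def using X y \<theta> by auto
  have L: "ls_mat X *\<^sub>v u \<in> carrier_vec k" using ls_mat_carrier u by auto
  have "X *\<^sub>v theta_LS X y = X *\<^sub>v \<theta> + X *\<^sub>v (ls_mat X *\<^sub>v u)"
    using theta_LS_decomp[OF y \<theta>] mult_add_distrib_mat_vec[OF X \<theta> L] by (simp add: u_def)
  moreover have "resid_mat X *\<^sub>v u = u - X *\<^sub>v (ls_mat X *\<^sub>v u)"
    unfolding resid_mat_def using X ls_mat_carrier u
    by (simp add: minus_mult_distrib_mat_vec[of _ n n] assoc_mult_mat_vec[of X n k _ n])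
  ultimately show ?thesis
    using X y \<theta> u L by (intro eq_vecI) (auto simp: u_def)
qed

lemma sigma_hat_eq:
  assumes y: "y \<in> carrier_vec n" and \<theta>: "\<theta> \<in> carrier_vec k"
  shows "sigma_hat X y =
    sqrt ((\<Sum>j<n. (\<Sum>l<n. resid_mat X $$ (j, l) * (y - X *\<^sub>v \<theta>) $ l)\<^sup>2) / (real n - real k))"
proof -
  have M: "resid_mat X \<in> carrier_mat n n"
    unfolding resid_mat_def using X ls_mat_carrier by auto
  have "dim_vec (y - X *\<^sub>v \<theta>) = n" using X by simp
  then show ?thesis
    unfolding sigma_hat_def Let_def residual_eq[OF y \<theta>] using X M
    by (simp add: scalar_prod_def lessThan_atLeast0 power2_eq_square)
qed

text \<open>With \<open>H = X * ls_mat X\<close> the hat matrix, \<open>H H\<^sup>T = H\<^sup>T\<close>. Hence the sum of squares of row \<open>j\<close> of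
  \<open>1 - H\<close> is \<open>1 - H\<^sub>j\<^sub>j\<close>, and the trace of \<open>H\<close> is that of \<open>ls_mat X * X = 1\<close>, which is \<open>k\<close>.\<close>
lemma resid_mat_squares: "(\<Sum>j<n. \<Sum>l<n. (resid_mat X $$ (j, l))\<^sup>2) = real n - real k"
proof -
  define H where "H = X * ls_mat X"
  have H: "H \<in> carrier_mat n n" unfolding H_def using X ls_mat_carrier by simp
  have "H * transpose_mat H = X * (ls_mat X * transpose_mat (ls_mat X)) * transpose_mat X"
    unfolding H_def using X ls_mat_carrier
    by (simp add: transpose_mult[of X n k _ n] assoc_mult_mat[of _ n k _ n _ n] assoc_mult_mat[of _ n k _ k _ n] assoc_mult_mat[of _ k n _ k _ n])
  also have "\<dots> = X * transpose_mat (inv_mat (transpose_mat X * X)) * transpose_mat X"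
    by (simp add: ls_mat_gram)
  also have "\<dots> = transpose_mat H"
    unfolding H_def ls_mat_def using X gram_inverse(1)[OF X rank]
    by (simp add: transpose_mult[of X n k _ n] transpose_mult[of _ k k _ n])
  finally have symm: "H * transpose_mat H = transpose_mat H" .
  have HH: "(\<Sum>l<n. H $$ (j, l) * H $$ (j, l)) = H $$ (j, j)" if "j < n" for j
  proof -
    have "(\<Sum>l<n. H $$ (j, l) * H $$ (j, l)) = (H * transpose_mat H) $$ (j, j)"
      using H that by (simp add: scalar_prod_def lessThan_atLeast0)
    then show ?thesis using H that by (simp add: symm)
  qed
  have "(\<Sum>l<n. (resid_mat X $$ (j, l))\<^sup>2) = 1 - H $$ (j, j)" if j: "j < n" for j
  proof -
    have "(\<Sum>l<n. (resid_mat X $$ (j, l))\<^sup>2)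
        = (\<Sum>l<n. (if l = j then 1 - 2 * H $$ (j, l) else 0) + H $$ (j, l) * H $$ (j, l))"
      unfolding resid_mat_def H_def[symmetric] using H X j
      by (intro sum.cong) (auto simp: power2_eq_square algebra_simps)
    also have "\<dots> = 1 - H $$ (j, j)"
      using j by (simp add: sum.distrib HH)
    finally show ?thesis .
  qed
  then have "(\<Sum>j<n. \<Sum>l<n. (resid_mat X $$ (j, l))\<^sup>2) = real n - (\<Sum>j<n. H $$ (j, j))"
    by (simp add: sum_subtractf)
  also have "(\<Sum>j<n. H $$ (j, j)) = (\<Sum>j<n. \<Sum>a<k. X $$ (j, a) * ls_mat X $$ (a, j))"
    unfolding H_def using X ls_mat_carrier by (simp add: scalar_prod_def lessThan_atLeast0)
  also have "\<dots> = (\<Sum>a<k. \<Sum>j<n. ls_mat X $$ (a, j) * X $$ (j, a))"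
    by (subst sum.swap) (simp add: mult.commute)
  also have "\<dots> = (\<Sum>a<k. (ls_mat X * X) $$ (a, a))"
    using X ls_mat_carrier by (simp add: scalar_prod_def lessThan_atLeast0)
  also have "\<dots> = real k" by (simp add: ls_mat_left_inverse)
  finally show ?thesis .
qed

end

section \<open>Linear and quadratic forms in independent normal variables\<close>

context prob_space
begin

lemma indep_normal_linear_combination:
  fixes U :: "nat \<Rightarrow> 'a \<Rightarrow> real" and c :: "nat \<Rightarrow> real"
  assumes indep: "indep_vars (\<lambda>_. borel) U {..<n}"
    and normal: "\<And>r. r < n \<Longrightarrow> distributed M lborel (U r) (normal_density 0 \<sigma>)"
    and "0 < \<sigma>" and pos: "0 < (\<Sum>r<n. (c r)\<^sup>2)"
  shows "distributed M lborel (\<lambda>\<omega>. \<Sum>r<n. c r * U r \<omega>)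
    (normal_density 0 (\<sigma> * sqrt (\<Sum>r<n. (c r)\<^sup>2)))"
proof -
  \<comment> \<open>The convolution rule for normal laws needs positive variances, so zero coefficients are dropped.\<close>
  define J where "J = {r \<in> {..<n}. c r \<noteq> 0}"
  have J: "finite J" "J \<subseteq> {..<n}" by (auto simp: J_def)
  have to_J: "(\<Sum>r<n. c r * x r) = (\<Sum>r\<in>J. c r * x r)" "(\<Sum>r<n. (c r)\<^sup>2) = (\<Sum>r\<in>J. (c r)\<^sup>2)" for x
    by (intro sum.mono_neutral_right; force simp: J_def)+
  have "distributed M lborel (\<lambda>\<omega>. \<Sum>r\<in>J. c r * U r \<omega>)
      (normal_density (\<Sum>r\<in>J. 0) (sqrt (\<Sum>r\<in>J. (\<bar>c r\<bar> * \<sigma>)\<^sup>2)))"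
  proof (rule sum_indep_normal)
    show "J \<noteq> {}" using pos to_J by auto
    show "indep_vars (\<lambda>_. borel) (\<lambda>r \<omega>. c r * U r \<omega>) J"
      using indep_vars_compose2[OF indep_vars_subset[OF indep J(2)], of "\<lambda>r x. c r * x"] by simp
    show "distributed M lborel (\<lambda>\<omega>. c r * U r \<omega>) (normal_density 0 (\<bar>c r\<bar> * \<sigma>))" if "r \<in> J" for r
      using normal_density_affine[OF normal \<open>0 < \<sigma>\<close>, of r "c r" 0] that by (simp add: J_def)
  qed (use \<open>0 < \<sigma>\<close> in \<open>auto simp: J_def\<close>)
  moreover have "sqrt (\<Sum>r\<in>J. (\<bar>c r\<bar> * \<sigma>)\<^sup>2) = \<sigma> * sqrt (\<Sum>r\<in>J. (c r)\<^sup>2)"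
    using \<open>0 < \<sigma>\<close> by (simp add: power_mult_distrib flip: sum_distrib_right) (simp add: real_sqrt_mult)
  ultimately show ?thesis by (simp add: to_J)
qed

lemma normal_even_moment:
  fixes Z :: "'a \<Rightarrow> real"
  assumes "0 < s" and Z: "distributed M lborel Z (normal_density 0 s)"
  shows "has_bochner_integral M (\<lambda>\<omega>. Z \<omega> ^ (2 * m)) (fact (2 * m) / ((2 / s\<^sup>2) ^ m * fact m))"
  using normal_moment_even[OF \<open>0 < s\<close>, of 0 m]
    distributed_integrable[OF Z, of "\<lambda>x. x ^ (2 * m)"] distributed_integral[OF Z, of "\<lambda>x. x ^ (2 * m)"]
  by (auto simp: has_bochner_integral_iff)

lemma linear_combination_moments:
  fixes U :: "nat \<Rightarrow> 'a \<Rightarrow> real" and c :: "nat \<Rightarrow> real"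
  assumes indep: "indep_vars (\<lambda>_. borel) U {..<n}"
    and normal: "\<And>r. r < n \<Longrightarrow> distributed M lborel (U r) (normal_density 0 \<sigma>)"
    and "0 < \<sigma>"
  defines "w \<equiv> \<Sum>r<n. (c r)\<^sup>2"
  shows "has_bochner_integral M (\<lambda>\<omega>. (\<Sum>r<n. c r * U r \<omega>)\<^sup>2) (\<sigma>\<^sup>2 * w)"
    and "has_bochner_integral M (\<lambda>\<omega>. (\<Sum>r<n. c r * U r \<omega>) ^ 4) (3 * \<sigma> ^ 4 * w\<^sup>2)"
proof -
  have "0 \<le> w" unfolding w_def by (simp add: sum_nonneg)
  have "has_bochner_integral M (\<lambda>\<omega>. (\<Sum>r<n. c r * U r \<omega>)\<^sup>2) (\<sigma>\<^sup>2 * w) \<and>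
    has_bochner_integral M (\<lambda>\<omega>. (\<Sum>r<n. c r * U r \<omega>) ^ 4) (3 * \<sigma> ^ 4 * w\<^sup>2)"
  proof (cases "w = 0")
    case True
    then have "\<forall>r<n. c r = 0" by (simp add: w_def sum_nonneg_eq_0_iff)
    then show ?thesis using True by (simp add: has_bochner_integral_zero)
  next
    case False
    then have w: "0 < w" using \<open>0 \<le> w\<close> by simp
    then have pos: "0 < \<sigma> * sqrt w" using \<open>0 < \<sigma>\<close> by simp
    note Z = indep_normal_linear_combination[OF indep normal \<open>0 < \<sigma>\<close> w[unfolded w_def], folded w_def]
    have "(sqrt w)^4 = w\<^sup>2" using w power_mult[of "sqrt w" 2 2] by simp
    then show ?thesis
      using normal_even_moment[OF pos Z, of 1] normal_even_moment[OF pos Z, of 2] w \<open>0 < \<sigma>\<close>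
      by (simp add: fact_numeral power_mult_distrib power_divide power2_eq_square power4_eq_xxxx[of \<sigma>] field_simps)
  qed
  then show "has_bochner_integral M (\<lambda>\<omega>. (\<Sum>r<n. c r * U r \<omega>)\<^sup>2) (\<sigma>\<^sup>2 * w)"
    and "has_bochner_integral M (\<lambda>\<omega>. (\<Sum>r<n. c r * U r \<omega>) ^ 4) (3 * \<sigma> ^ 4 * w\<^sup>2)" by auto
qed

text \<open>The density is at most \<open>1 / (s \<surd>(2 \<pi>)) \<le> 1 / (2 s)\<close>, and the interval has length \<open>2 e\<close>.\<close>
lemma normal_concentration_le:
  fixes Z :: "'a \<Rightarrow> real"
  assumes "0 < s" and Z: "distributed M lborel Z (normal_density 0 s)" and "0 \<le> e"
  shows "\<P>(\<omega> in M. \<bar>Z \<omega>\<bar> \<le> e) \<le> e / s"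
proof -
  have density_le: "normal_density 0 s x \<le> 1 / (2 * s)" for x
  proof -
    have "2 \<le> sqrt (2 * pi)" using pi_gt3 by (intro real_le_rsqrt) simp
    then have "2 * s \<le> sqrt (2 * pi * s\<^sup>2)" using \<open>0 < s\<close> by (simp add: real_sqrt_mult)
    then have "1 / sqrt (2 * pi * s\<^sup>2) * exp (- x\<^sup>2 / (2 * s\<^sup>2)) \<le> 1 / (2 * s) * 1"
      using \<open>0 < s\<close> by (intro mult_mono divide_left_mono) auto
    then show ?thesis by (simp add: normal_density_def)
  qed
  have "{\<omega> \<in> space M. \<bar>Z \<omega>\<bar> \<le> e} = Z -` {-e..e} \<inter> space M" by (auto simp: abs_le_iff)
  then have "emeasure M {\<omega> \<in> space M. \<bar>Z \<omega>\<bar> \<le> e} = (\<integral>\<^sup>+x. ennreal (normal_density 0 s x) * indicator {-e..e} x \<partial>lborel)"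
    by (simp add: distributed_emeasure[OF Z])
  also have "\<dots> \<le> (\<integral>\<^sup>+x. ennreal (1 / (2 * s)) * indicator {-e..e} x \<partial>lborel)"
    by (intro nn_integral_mono mult_right_mono ennreal_leI density_le) auto
  also have "\<dots> = ennreal (1 / (2 * s)) * ennreal (2 * e)"
    using \<open>0 \<le> e\<close> by (simp add: nn_integral_cmult_indicator)
  also have "\<dots> = ennreal (e / s)"
    using \<open>0 \<le> e\<close> \<open>0 < s\<close> by (simp flip: ennreal_mult)
  finally show ?thesis
    using \<open>0 \<le> e\<close> \<open>0 < s\<close> by (simp add: emeasure_eq_measure)
qed

lemma quadratic_form_mean:
  fixes U :: "nat \<Rightarrow> 'a \<Rightarrow> real" and m :: "nat \<Rightarrow> nat \<Rightarrow> real"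
  assumes indep: "indep_vars (\<lambda>_. borel) U {..<n}"
    and normal: "\<And>r. r < n \<Longrightarrow> distributed M lborel (U r) (normal_density 0 \<sigma>)"
    and "0 < \<sigma>"
  shows "has_bochner_integral M (\<lambda>\<omega>. \<Sum>j<n. (\<Sum>l<n. m j l * U l \<omega>)\<^sup>2)
    (\<sigma>\<^sup>2 * (\<Sum>j<n. \<Sum>l<n. (m j l)\<^sup>2))"
  unfolding sum_distrib_left[of _ _ "{..<n}" for f]
  using linear_combination_moments(1)[OF indep normal \<open>0 < \<sigma>\<close>]
  by (intro has_bochner_integral_sum) (auto simp: sum_distrib_left)

text \<open>A second-moment argument in the style of Paley and Zygmund. The normalised form \<open>S\<close> has mean 1,
  and its second moment is at most 3: by the Cauchy-Schwarz inequality with weights \<open>w\<^sub>j\<close> (the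
  variances of the linear forms), \<open>S\<^sup>2\<close> is dominated by a weighted sum \<open>V\<close> of fourth powers of
  normal variables, each of which has known mean. The bound holds uniformly, however the linear forms
  depend on each other.\<close>
lemma quadratic_form_lower_bound:
  fixes U :: "nat \<Rightarrow> 'a \<Rightarrow> real" and m :: "nat \<Rightarrow> nat \<Rightarrow> real"
  assumes indep: "indep_vars (\<lambda>_. borel) U {..<n}"
    and normal: "\<And>r. r < n \<Longrightarrow> distributed M lborel (U r) std_normal_density"
    and d: "d = (\<Sum>j<n. \<Sum>l<n. (m j l)\<^sup>2)" "0 < d"
  shows "3 / 14 \<le> \<P>(\<omega> in M. 1 / 4 \<le> (\<Sum>j<n. (\<Sum>l<n. m j l * U l \<omega>)\<^sup>2) / d)"
proof -
  define w where "w j = (\<Sum>l<n. (m j l)\<^sup>2)" for j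
  define L where "L j \<omega> = (\<Sum>l<n. m j l * U l \<omega>)" for j \<omega>
  define S where "S \<omega> = (\<Sum>j<n. (L j \<omega>)\<^sup>2) / d" for \<omega>
  define V where "V \<omega> = (\<Sum>j<n. (L j \<omega>) ^ 4 / w j) / d" for \<omega>
  have d': "d = (\<Sum>j<n. w j)" unfolding d w_def ..
  have w0: "0 \<le> w j" for j unfolding w_def by (simp add: sum_nonneg)
  have ES: "has_bochner_integral M S 1"
    using has_bochner_integral_divide_zero[OF quadratic_form_mean[OF indep normal, of m], of d] d
    by (simp add: S_def[abs_def] L_def[abs_def])
  have "has_bochner_integral M (\<lambda>\<omega>. (L j \<omega>) ^ 4 / w j) (3 * w j)" for j
    using has_bochner_integral_divide_zero[OF linear_combination_moments(2)[OF indep normal, of "m j"], of "w j"]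
    by (auto simp: L_def w_def power2_eq_square split: if_splits)
  then have "has_bochner_integral M V ((\<Sum>j<n. 3 * w j) / d)"
    unfolding V_def by (intro has_bochner_integral_divide_zero has_bochner_integral_sum) auto
  then have EV: "has_bochner_integral M V 3"
    using d by (simp add: d' flip: sum_distrib_left)
  have S2: "(S \<omega>)\<^sup>2 \<le> V \<omega>" for \<omega>
  proof -
    \<comment> \<open>Forms of variance 0 vanish identically, so the convention \<open>x / 0 = 0\<close> does no harm below.\<close>
    have "L j \<omega> = 0" if "w j = 0" "j < n" for j
    proof -
      have "\<forall>l<n. m j l = 0" using that by (simp add: w_def sum_nonneg_eq_0_iff)
      then show ?thesis by (simp add: L_def)
    qed
    then have "(\<Sum>j<n. (L j \<omega>)\<^sup>2) = (\<Sum>j<n. sqrt (w j) * ((L j \<omega>)\<^sup>2 / sqrt (w j)))"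
      by (intro sum.cong) auto
    then have "(\<Sum>j<n. (L j \<omega>)\<^sup>2)\<^sup>2 \<le> (\<Sum>j<n. (sqrt (w j))\<^sup>2) * (\<Sum>j<n. ((L j \<omega>)\<^sup>2 / sqrt (w j))\<^sup>2)"
      using Cauchy_Schwarz_ineq_sum[of "\<lambda>j. sqrt (w j)" "\<lambda>j. (L j \<omega>)\<^sup>2 / sqrt (w j)" "{..<n}"] by simp
    also have "\<dots> = d * (\<Sum>j<n. (L j \<omega>) ^ 4 / w j)"
      using w0 by (simp add: d' power_divide flip: power_mult)
    finally show ?thesis
      using \<open>0 < d\<close> by (simp add: S_def V_def power_divide field_simps power2_eq_square)
  qed
  have [measurable]: "S \<in> borel_measurable M" using ES by (simp add: has_bochner_integral_iff integrable_iff_bounded)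
  \<comment> \<open>A quadratic minorant of the indicator: it is at most 0 for \<open>S < 1/4\<close>, and at most 1 because
    \<open>(S - 4)\<^sup>2 \<ge> 0\<close>.\<close>
  have lower: "(4 * S \<omega> - V \<omega> / 2 - 1) / 7 \<le> indicator {\<omega> \<in> space M. 1 / 4 \<le> S \<omega>} \<omega>" if "\<omega> \<in> space M" for \<omega>
  proof (cases "1 / 4 \<le> S \<omega>")
    case True
    have "0 \<le> (S \<omega> - 4)\<^sup>2" by simp
    then show ?thesis using True S2[of \<omega>] that by (simp add: power2_eq_square algebra_simps)
  next
    case False
    have "0 \<le> V \<omega>" using S2[of \<omega>] zero_le_power2[of "S \<omega>"] by linarith
    then show ?thesis using False by simp
  qed
  have minorant: "has_bochner_integral M (\<lambda>\<omega>. (4 * S \<omega> - V \<omega> / 2 - 1) / 7) ((4 * 1 - 3 / 2 - 1) / 7)"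
    using ES EV by (intro has_bochner_integral_divide_zero has_bochner_integral_diff
        has_bochner_integral_mult_right) (auto simp: has_bochner_integral_iff prob_space)
  have event: "has_bochner_integral M (indicator {\<omega> \<in> space M. 1 / 4 \<le> S \<omega>} :: 'a \<Rightarrow> real)
      (\<P>(\<omega> in M. 1 / 4 \<le> S \<omega>))"
    by (intro has_bochner_integral_real_indicator) (auto simp: emeasure_eq_measure)
  have "(4 * 1 - 3 / 2 - 1) / 7 \<le> \<P>(\<omega> in M. 1 / 4 \<le> S \<omega>)"
    using integral_mono[OF integrable.intros[OF minorant] integrable.intros[OF event] lower]
    unfolding has_bochner_integral_integral_eq[OF minorant] has_bochner_integral_integral_eq[OF event] .
  then show ?thesis by (simp add: S_def L_def)
qed

end

text \<open>Independence turns the joint law into the product of the marginal laws. The two probability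
  spaces are unrelated, since the regression model has its own measure for each parameter.\<close>
lemma indep_normal_same_law:
  fixes U :: "nat \<Rightarrow> 'a \<Rightarrow> real" and U' :: "nat \<Rightarrow> 'b \<Rightarrow> real"
  assumes A: "prob_space A" "prob_space.indep_vars A (\<lambda>_. borel) U {..<n}"
      "\<And>r. r < n \<Longrightarrow> distributed A lborel (U r) (normal_density 0 \<sigma>)"
    and B: "prob_space B" "prob_space.indep_vars B (\<lambda>_. borel) U' {..<n}"
      "\<And>r. r < n \<Longrightarrow> distributed B lborel (U' r) (normal_density 0 \<sigma>)"
    and "1 \<le> n" and D: "D \<in> sets (PiM {..<n} (\<lambda>_. borel))"
  shows "\<P>(\<omega> in A. (\<lambda>r\<in>{..<n}. U r \<omega>) \<in> D) = \<P>(\<omega> in B. (\<lambda>r\<in>{..<n}. U' r \<omega>) \<in> D)"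
proof -
  have law: "\<P>(\<omega> in N. (\<lambda>r\<in>{..<n}. W r \<omega>) \<in> D)
      = measure (PiM {..<n} (\<lambda>_. distr (density lborel (normal_density 0 \<sigma>)) borel (\<lambda>x. x))) D"
    if "prob_space N" "prob_space.indep_vars N (\<lambda>_. borel) W {..<n}"
      "\<And>r. r < n \<Longrightarrow> distributed N lborel (W r) (normal_density 0 \<sigma>)"
    for N :: "'c measure" and W
  proof -
    interpret prob_space N by fact
    have W: "W r \<in> borel_measurable N" if "r < n" for r
      using distributed_measurable[OF \<open>r < n \<Longrightarrow> distributed N lborel (W r) (normal_density 0 \<sigma>)\<close>[OF that]] by simp
    have marginal: "distr N borel (W r) = distr (density lborel (normal_density 0 \<sigma>)) borel (\<lambda>x. x)"
      if "r < n" for r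
    proof -
      have "distr N borel (W r) = distr (distr N lborel (W r)) borel (\<lambda>x. x)"
        using W[OF that] by (subst distr_distr) (auto simp: comp_def)
      then show ?thesis
        using distributed_distr_eq_density[OF \<open>r < n \<Longrightarrow> distributed N lborel (W r) (normal_density 0 \<sigma>)\<close>[OF that]] by simp
    qed
    have "distr N (PiM {..<n} (\<lambda>_. borel)) (\<lambda>\<omega>. \<lambda>r\<in>{..<n}. W r \<omega>) = PiM {..<n} (\<lambda>r. distr N borel (W r))"
      using indep_vars_iff_distr_eq_PiM'[of "{..<n}" W "\<lambda>_. borel"] W that(2) \<open>1 \<le> n\<close> by (auto simp: lessThan_empty_iff)
    also have "\<dots> = PiM {..<n} (\<lambda>_. distr (density lborel (normal_density 0 \<sigma>)) borel (\<lambda>x. x))"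
      using marginal by (intro PiM_cong) auto
    finally have eq: "distr N (PiM {..<n} (\<lambda>_. borel)) (\<lambda>\<omega>. \<lambda>r\<in>{..<n}. W r \<omega>) = \<dots>" .
    have "(\<lambda>\<omega>. \<lambda>r\<in>{..<n}. W r \<omega>) \<in> N \<rightarrow>\<^sub>M PiM {..<n} (\<lambda>_. borel)"
      using W by (intro measurable_restrict) auto
    then show ?thesis
      using D by (simp add: eq[symmetric] measure_distr vimage_def Int_def conj_commute)
  qed
  show ?thesis using law[OF A] law[OF B] by simp
qed

section \<open>The estimation error as a function of the regression errors\<close>

text \<open>The scale that multiplies \<open>\<xi> \<eta>\<close> in the threshold, written as a function of the errors: the
  residual standard error for the feasible estimators, \<open>\<sigma>\<close> for the infeasible ones.\<close>
definition error_scale :: "bool \<Rightarrow> real mat \<Rightarrow> real \<Rightarrow> (nat \<Rightarrow> real) \<Rightarrow> real" where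
  "error_scale feasible X \<sigma> u =
     (if feasible
      then sqrt ((\<Sum>j<dim_row X. (\<Sum>l<dim_row X. resid_mat X $$ (j, l) * u l)\<^sup>2) /
                 (real (dim_row X) - real (dim_col X)))
      else \<sigma>)"

definition noise :: "real mat \<Rightarrow> nat \<Rightarrow> (nat \<Rightarrow> real) \<Rightarrow> real" where
  "noise X i u = (\<Sum>r<dim_row X. ls_mat X $$ (i, r) * u r)"

lemma noise_restrict: "noise X i (\<lambda>r\<in>{..<dim_row X}. u r) = noise X i u"
  unfolding noise_def by (intro sum.cong) auto

lemma error_scale_restrict: "error_scale feasible X \<sigma> (\<lambda>r\<in>{..<dim_row X}. u r) = error_scale feasible X \<sigma> u"
proof -
  have "(\<Sum>l<dim_row X. resid_mat X $$ (j, l) * (\<lambda>r\<in>{..<dim_row X}. u r) l)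
      = (\<Sum>l<dim_row X. resid_mat X $$ (j, l) * u l)" for j
    by (intro sum.cong) auto
  then show ?thesis unfolding error_scale_def by simp
qed

lemma noise_measurable:
  assumes "\<And>r. r < dim_row X \<Longrightarrow> (\<lambda>\<omega>. U \<omega> r) \<in> borel_measurable M"
  shows "(\<lambda>\<omega>. noise X i (U \<omega>)) \<in> borel_measurable M"
  unfolding noise_def using assms by (intro borel_measurable_sum borel_measurable_times) auto

lemma error_scale_measurable:
  assumes "\<And>r. r < dim_row X \<Longrightarrow> (\<lambda>\<omega>. U \<omega> r) \<in> borel_measurable M"
  shows "(\<lambda>\<omega>. error_scale feasible X \<sigma> (U \<omega>)) \<in> borel_measurable M"
proof -
  have "(\<lambda>\<omega>. (\<Sum>l<dim_row X. resid_mat X $$ (j, l) * U \<omega> l)) \<in> borel_measurable M" for j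
    using assms by (intro borel_measurable_sum borel_measurable_times) auto
  then have "(\<lambda>\<omega>. sqrt ((\<Sum>j<dim_row X. (\<Sum>l<dim_row X. resid_mat X $$ (j, l) * U \<omega> l)\<^sup>2) /
                 (real (dim_row X) - real (dim_col X)))) \<in> borel_measurable M"
    by measurable
  then show ?thesis unfolding error_scale_def by (cases feasible) auto
qed

lemma error_scale_nonneg:
  assumes "0 < \<sigma>" "feasible \<Longrightarrow> dim_col X < dim_row X"
  shows "0 \<le> error_scale feasible X \<sigma> u"
  unfolding error_scale_def using assms by (auto intro!: divide_nonneg_nonneg sum_nonneg)

locale gaussian_design =
  fixes n k :: nat and X :: "real mat" and Y :: "'a \<Rightarrow> real vec"
    and P :: "real vec \<Rightarrow> real \<Rightarrow> 'a measure" and i :: nat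
  assumes model: "gaussian_regression n k X Y P"
    and n: "1 \<le> n" and i: "i < k"
begin

abbreviation err :: "real vec \<Rightarrow> nat \<Rightarrow> 'a \<Rightarrow> real" where
  "err \<theta> r \<omega> \<equiv> (Y \<omega> - X *\<^sub>v \<theta>) $ r"

lemma X_carrier: "X \<in> carrier_mat n k" and X_rank: "vec_space.rank n X = k"
  using model by (auto simp: gaussian_regression_def)

lemma dim_X: "dim_row X = n" "dim_col X = k"
  using X_carrier by auto

lemma xi_pos: "0 < xi X i"
  using xi_eq[OF X_carrier X_rank n i] ls_row_nonzero[OF X_carrier X_rank i] n by simp

lemma ls_row_squares: "(\<Sum>r<n. (ls_mat X $$ (i, r))\<^sup>2) = (xi X i / sqrt (real n))\<^sup>2"
  using xi_eq[OF X_carrier X_rank n i] n by (simp add: power_divide sum_nonneg)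

lemma errors:
  assumes "\<theta> \<in> carrier_vec k" "0 < \<sigma>"
  shows "prob_space (P \<theta> \<sigma>)" and "prob_space.indep_vars (P \<theta> \<sigma>) (\<lambda>_. borel) (err \<theta>) {..<n}"
    and "\<And>r. r < n \<Longrightarrow> distributed (P \<theta> \<sigma>) lborel (err \<theta> r) (normal_density 0 \<sigma>)"
    and "\<And>r. r < n \<Longrightarrow> err \<theta> r \<in> borel_measurable (P \<theta> \<sigma>)"
    and "\<And>\<omega>. \<omega> \<in> space (P \<theta> \<sigma>) \<Longrightarrow> Y \<omega> \<in> carrier_vec n"
proof -
  have m: "prob_space (P \<theta> \<sigma>) \<and>
        (\<forall>\<omega>\<in>space (P \<theta> \<sigma>). Y \<omega> \<in> carrier_vec n) \<and>
        prob_space.indep_vars (P \<theta> \<sigma>) (\<lambda>_. borel) (err \<theta>) {..<n} \<and>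
        (\<forall>r<n. distributed (P \<theta> \<sigma>) lborel (err \<theta> r) (normal_density 0 \<sigma>))"
    using model assms unfolding gaussian_regression_def by blast
  then show "prob_space (P \<theta> \<sigma>)" and "prob_space.indep_vars (P \<theta> \<sigma>) (\<lambda>_. borel) (err \<theta>) {..<n}"
    and dist: "\<And>r. r < n \<Longrightarrow> distributed (P \<theta> \<sigma>) lborel (err \<theta> r) (normal_density 0 \<sigma>)"
    and "\<And>\<omega>. \<omega> \<in> space (P \<theta> \<sigma>) \<Longrightarrow> Y \<omega> \<in> carrier_vec n"
    by blast+
  show "err \<theta> r \<in> borel_measurable (P \<theta> \<sigma>)" if "r < n" for r
    using distributed_measurable[OF dist[OF that]] by simp
qed

end

section \<open>The two estimates at a fixed sample size\<close>

locale thresholding_estimator = gaussian_design n k X Y P i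
  for n k :: nat and X :: "real mat" and Y :: "'a \<Rightarrow> real vec"
    and P :: "real vec \<Rightarrow> real \<Rightarrow> 'a measure" and i :: nat +
  fixes T :: "real \<Rightarrow> real \<Rightarrow> real" and h :: real and feasible :: bool
    and est :: "real \<Rightarrow> 'a \<Rightarrow> real"
  assumes T: "T \<in> {hard_thr, soft_thr, adaptive_soft_thr}" and h: "0 < h"
    and feasible: "feasible \<Longrightarrow> k < n"
    and est: "\<And>\<sigma> \<omega>. est \<sigma> \<omega> =
      (if feasible then feasible_est T X i h \<sigma> (Y \<omega>) else infeasible_est T X i h \<sigma> (Y \<omega>))"
begin

lemma est_eq:
  assumes "\<theta> \<in> carrier_vec k" "0 < \<sigma>" "\<omega> \<in> space (P \<theta> \<sigma>)"
  shows "est \<sigma> \<omega> = T (\<theta> $ i + noise X i (\<lambda>r. err \<theta> r \<omega>))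
    (error_scale feasible X \<sigma> (\<lambda>r. err \<theta> r \<omega>) * (xi X i * h))"
proof -
  have Y: "Y \<omega> \<in> carrier_vec n" using errors(5)[OF assms(1,2)] assms(3) .
  have dim: "dim_vec (Y \<omega> - X *\<^sub>v \<theta>) = n" using X_carrier by simp
  have "theta_LS X (Y \<omega>) $ i = \<theta> $ i + noise X i (\<lambda>r. err \<theta> r \<omega>)"
    using theta_LS_decomp[OF X_carrier X_rank Y assms(1)] ls_mat_carrier[OF X_carrier X_rank] i assms(1) dim
    by (simp add: noise_def dim_X scalar_prod_def lessThan_atLeast0)
  moreover have "(if feasible then sigma_hat X (Y \<omega>) else \<sigma>) = error_scale feasible X \<sigma> (\<lambda>r. err \<theta> r \<omega>)"
    using sigma_hat_eq[OF X_carrier X_rank Y assms(1)] by (simp add: error_scale_def dim_X)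
  ultimately show ?thesis
    unfolding est feasible_est_def infeasible_est_def by (auto simp: mult.assoc split: if_splits)
qed

lemma est_measurable:
  assumes "\<theta> \<in> carrier_vec k" "0 < \<sigma>"
  shows "est \<sigma> \<in> borel_measurable (P \<theta> \<sigma>)"
proof -
  have "(\<lambda>\<omega>. T (\<theta> $ i + noise X i (\<lambda>r. err \<theta> r \<omega>))
    (error_scale feasible X \<sigma> (\<lambda>r. err \<theta> r \<omega>) * (xi X i * h))) \<in> borel_measurable (P \<theta> \<sigma>)"
    using errors(4)[OF assms]
    by (intro thresholding_measurable[OF T] borel_measurable_add borel_measurable_times
        noise_measurable error_scale_measurable) (auto simp: dim_X)
  then show ?thesis
    using est_eq[OF assms] by (subst measurable_cong) auto
qed

lemma error_scale_second_moment:
  assumes "\<theta> \<in> carrier_vec k" "0 < \<sigma>"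
  shows "has_bochner_integral (P \<theta> \<sigma>) (\<lambda>\<omega>. (error_scale feasible X \<sigma> (\<lambda>r. err \<theta> r \<omega>))\<^sup>2) (\<sigma>\<^sup>2)"
proof -
  interpret prob_space "P \<theta> \<sigma>" by (rule errors(1)[OF assms])
  show ?thesis
  proof (cases feasible)
    case True
    then have "0 < real n - real k" using feasible by simp
    moreover have "has_bochner_integral (P \<theta> \<sigma>)
        (\<lambda>\<omega>. (\<Sum>j<n. (\<Sum>l<n. resid_mat X $$ (j, l) * err \<theta> l \<omega>)\<^sup>2) / (real n - real k))
        (\<sigma>\<^sup>2 * (real n - real k) / (real n - real k))"
      using quadratic_form_mean[OF errors(2,3)[OF assms] assms(2), of "\<lambda>j l. resid_mat X $$ (j, l)"]
      unfolding resid_mat_squares[OF X_carrier X_rank] by (intro has_bochner_integral_divide_zero)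
    ultimately show ?thesis
      using True by (simp add: error_scale_def dim_X sum_nonneg)
  next
    case False
    then show ?thesis by (simp add: error_scale_def has_bochner_integral_iff prob_space)
  qed
qed

lemma error_scale_lower_bound:
  assumes "\<theta> \<in> carrier_vec k"
  shows "3 / 14 \<le> \<P>(\<omega> in P \<theta> 1. 1 / 2 \<le> error_scale feasible X 1 (\<lambda>r. err \<theta> r \<omega>))"
proof -
  have one: "(0::real) < 1" by simp
  interpret prob_space "P \<theta> 1" by (rule errors(1)[OF assms one])
  show ?thesis
  proof (cases feasible)
    case True
    have half: "1 / 2 \<le> sqrt x \<longleftrightarrow> 1 / 4 \<le> x" for x :: real
      using real_sqrt_le_iff[of "1 / 4" x] by (simp add: real_sqrt_divide)
    show ?thesis
      using quadratic_form_lower_bound[OF errors(2,3)[OF assms one],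
          of "real n - real k" "\<lambda>j l. resid_mat X $$ (j, l)"]
        resid_mat_squares[OF X_carrier X_rank] feasible True
      by (simp only: error_scale_def dim_X half if_True) simp
  next
    case False
    then show ?thesis by (simp add: error_scale_def prob_space)
  qed
qed

text \<open>Markov's inequality for \<open>2 c\<^sup>2 (N\<^sup>2 + W\<^sup>2 v\<^sup>2)\<close>, which dominates the squared scaled error by
  \<open>(x + y)\<^sup>2 \<le> 2 (x\<^sup>2 + y\<^sup>2)\<close>.\<close>
lemma error_tail_bound:
  assumes "\<theta> \<in> carrier_vec k" "0 < \<sigma>" "0 \<le> c" "0 < B"
  shows "\<P>(\<omega> in P \<theta> \<sigma>. c * \<bar>est \<sigma> \<omega> - \<theta> $ i\<bar> > \<sigma> * B)
    \<le> 2 * c\<^sup>2 * ((xi X i / sqrt (real n))\<^sup>2 + (xi X i * h)\<^sup>2) / B\<^sup>2"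
proof -
  interpret prob_space "P \<theta> \<sigma>" by (rule errors(1)[OF assms(1,2)])
  define N where "N \<omega> = noise X i (\<lambda>r. err \<theta> r \<omega>)" for \<omega>
  define W where "W \<omega> = error_scale feasible X \<sigma> (\<lambda>r. err \<theta> r \<omega>)" for \<omega>
  define Q where "Q \<omega> = 2 * c\<^sup>2 * ((N \<omega>)\<^sup>2 + (W \<omega>)\<^sup>2 * (xi X i * h)\<^sup>2)" for \<omega>
  have N: "has_bochner_integral (P \<theta> \<sigma>) (\<lambda>\<omega>. (N \<omega>)\<^sup>2) (\<sigma>\<^sup>2 * (xi X i / sqrt (real n))\<^sup>2)"
    using linear_combination_moments(1)[OF errors(2,3)[OF assms(1,2)] assms(2), of "\<lambda>r. ls_mat X $$ (i, r)"]
    unfolding ls_row_squares by (simp add: N_def noise_def dim_X)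
  have W: "has_bochner_integral (P \<theta> \<sigma>) (\<lambda>\<omega>. (W \<omega>)\<^sup>2) (\<sigma>\<^sup>2)"
    unfolding W_def by (rule error_scale_second_moment[OF assms(1,2)])
  have Q: "has_bochner_integral (P \<theta> \<sigma>) Q
      (2 * c\<^sup>2 * (\<sigma>\<^sup>2 * (xi X i / sqrt (real n))\<^sup>2 + \<sigma>\<^sup>2 * (xi X i * h)\<^sup>2))"
    unfolding Q_def[abs_def]
    by (intro has_bochner_integral_mult_right has_bochner_integral_add has_bochner_integral_mult_left N W)
  have Q_nonneg: "0 \<le> Q \<omega>" for \<omega> by (simp add: Q_def)
  have imp: "(\<sigma> * B)\<^sup>2 \<le> Q \<omega>" if \<omega>: "\<omega> \<in> space (P \<theta> \<sigma>)" and "\<sigma> * B < c * \<bar>est \<sigma> \<omega> - \<theta> $ i\<bar>" for \<omega>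
  proof -
    have \<tau>: "0 \<le> W \<omega> * (xi X i * h)"
      unfolding W_def using error_scale_nonneg[OF assms(2), of feasible X] feasible xi_pos h by (simp add: dim_X)
    have "\<bar>est \<sigma> \<omega> - \<theta> $ i\<bar> \<le> \<bar>N \<omega>\<bar> + W \<omega> * (xi X i * h)"
      using thresholding_error_le[OF T \<tau>, of "\<theta> $ i + N \<omega>"] est_eq[OF assms(1,2) \<omega>]
      by (simp add: N_def W_def)
    then have "c * \<bar>est \<sigma> \<omega> - \<theta> $ i\<bar> \<le> c * (\<bar>N \<omega>\<bar> + W \<omega> * (xi X i * h))"
      by (rule mult_left_mono) fact
    then have "\<sigma> * B \<le> c * (\<bar>N \<omega>\<bar> + W \<omega> * (xi X i * h))"
      using that(2) by simp
    then have "(\<sigma> * B)\<^sup>2 \<le> (c * (\<bar>N \<omega>\<bar> + W \<omega> * (xi X i * h)))\<^sup>2"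
      using assms by (intro power_mono) auto
    also have "\<dots> = c\<^sup>2 * (\<bar>N \<omega>\<bar> + W \<omega> * (xi X i * h))\<^sup>2" by (simp add: power_mult_distrib)
    also have "\<dots> \<le> c\<^sup>2 * (2 * (\<bar>N \<omega>\<bar>\<^sup>2 + (W \<omega> * (xi X i * h))\<^sup>2))"
      using sum_squares_bound[of "\<bar>N \<omega>\<bar>" "W \<omega> * (xi X i * h)"]
      by (intro mult_left_mono) (auto simp: power2_sum)
    also have "\<dots> = Q \<omega>" by (simp add: Q_def power_mult_distrib)
    finally show ?thesis .
  qed
  have [measurable]: "Q \<in> borel_measurable (P \<theta> \<sigma>)" using Q by (simp add: has_bochner_integral_iff borel_measurable_integrable)
  have "\<P>(\<omega> in P \<theta> \<sigma>. c * \<bar>est \<sigma> \<omega> - \<theta> $ i\<bar> > \<sigma> * B) \<le> \<P>(\<omega> in P \<theta> \<sigma>. (\<sigma> * B)\<^sup>2 \<le> Q \<omega>)"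
    by (intro finite_measure_mono) (use imp in auto)
  also have "\<dots> \<le> (\<integral>\<omega>. Q \<omega> \<partial>P \<theta> \<sigma>) / (\<sigma> * B)\<^sup>2"
    by (intro integral_Markov_inequality_measure[where A = "{}"])
      (use integrable.intros[OF Q] assms Q_nonneg in auto)
  also have "\<dots> = 2 * c\<^sup>2 * ((xi X i / sqrt (real n))\<^sup>2 + (xi X i * h)\<^sup>2) / B\<^sup>2"
    using has_bochner_integral_integral_eq[OF Q] assms
    by (simp add: power_mult_distrib field_simps flip: distrib_left)
  finally show ?thesis .
qed

text \<open>The converse of the tail bound: accuracy at the two parameter values \<open>t\<close> and \<open>- t\<close> is possible
  only if both sources of error are small. The constant \<open>1 / 20\<close> is chosen such that the good event
  \<open>G\<close>, of probability at least \<open>9 / 10\<close>, must meet the event \<open>W \<ge> 1 / 2\<close>, whose probability is at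
  least \<open>3 / 14\<close>.\<close>
lemma accuracy_bounds_scales:
  assumes \<theta>: "\<theta> \<in> carrier_vec k" "\<theta> $ i = t" and \<theta>': "\<theta>' \<in> carrier_vec k" "\<theta>' $ i = - t"
    and "0 < e" "e < t"
    and plus: "\<P>(\<omega> in P \<theta> 1. e < \<bar>est 1 \<omega> - t\<bar>) \<le> 1 / 20"
    and minus: "\<P>(\<omega> in P \<theta>' 1. e < \<bar>est 1 \<omega> - (- t)\<bar>) \<le> 1 / 20"
  shows "xi X i / sqrt (real n) \<le> 2 * e \<and> xi X i * h \<le> 2 * t"
proof -
  define N where "N u = noise X i u" for u
  define \<tau> where "\<tau> u = error_scale feasible X 1 u * (xi X i * h)" for u
  define bad where "bad = {u \<in> space (PiM {..<n} (\<lambda>_. borel)). e < \<bar>T (- t + N u) (\<tau> u) - (- t)\<bar>}"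
  define U where "U = (\<lambda>\<omega> r. err \<theta> r \<omega>)"
  have one: "(0::real) < 1" by simp
  interpret prob_space "P \<theta> 1" by (rule errors(1)[OF \<theta>(1) one])
  note [measurable] = est_measurable[OF \<theta>(1) one]
  have U: "(\<lambda>\<omega>. U \<omega> r) \<in> borel_measurable (P \<theta> 1)" if "r < n" for r
    unfolding U_def using errors(4)[OF \<theta>(1) one that] .
  have [measurable]: "(\<lambda>\<omega>. N (U \<omega>)) \<in> borel_measurable (P \<theta> 1)" "(\<lambda>\<omega>. \<tau> (U \<omega>)) \<in> borel_measurable (P \<theta> 1)"
      "(\<lambda>\<omega>. error_scale feasible X 1 (U \<omega>)) \<in> borel_measurable (P \<theta> 1)"
    unfolding N_def \<tau>_def using U
    by (intro borel_measurable_times noise_measurable error_scale_measurable; simp add: dim_X)+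
  have [measurable]: "(\<lambda>\<omega>. T (- t + N (U \<omega>)) (\<tau> (U \<omega>))) \<in> borel_measurable (P \<theta> 1)"
    by (intro thresholding_measurable[OF T]) measurable
  have "N \<in> borel_measurable (PiM {..<n} (\<lambda>_. borel))" "\<tau> \<in> borel_measurable (PiM {..<n} (\<lambda>_. borel))"
    unfolding N_def \<tau>_def
    by (intro borel_measurable_times noise_measurable error_scale_measurable; simp add: dim_X)+
  then have [measurable]: "(\<lambda>u. T (- t + N u) (\<tau> u)) \<in> borel_measurable (PiM {..<n} (\<lambda>_. borel))"
    by (intro thresholding_measurable[OF T]) measurable
  have bad: "bad \<in> sets (PiM {..<n} (\<lambda>_. borel))" unfolding bad_def by measurable
  have restrict: "N (\<lambda>r\<in>{..<n}. u r) = N u" "\<tau> (\<lambda>r\<in>{..<n}. u r) = \<tau> u" for u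
    using noise_restrict[of X i u] error_scale_restrict[of feasible X 1 u] by (auto simp: N_def \<tau>_def dim_X)
  have in_bad: "(\<lambda>r\<in>{..<n}. u r) \<in> bad \<longleftrightarrow> e < \<bar>T (- t + N u) (\<tau> u) - (- t)\<bar>" for u
    unfolding bad_def by (simp add: restrict space_PiM)
  \<comment> \<open>The coupling: the error event under \<open>\<theta>'\<close> depends only on the errors, whose law is the same
    under \<open>\<theta>\<close>.\<close>
  have "\<P>(\<omega> in P \<theta> 1. e < \<bar>T (- t + N (U \<omega>)) (\<tau> (U \<omega>)) - (- t)\<bar>)
      = \<P>(\<omega> in P \<theta> 1. (\<lambda>r\<in>{..<n}. err \<theta> r \<omega>) \<in> bad)"
    by (simp add: in_bad U_def)
  also have "\<dots> = \<P>(\<omega> in P \<theta>' 1. (\<lambda>r\<in>{..<n}. err \<theta>' r \<omega>) \<in> bad)"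
    using \<theta>(1) \<theta>'(1) n bad
    by (intro indep_normal_same_law[where \<sigma> = 1] errors(1,2,3)) auto
  also have "\<dots> = \<P>(\<omega> in P \<theta>' 1. e < \<bar>est 1 \<omega> - (- t)\<bar>)"
    by (intro arg_cong[where f = "measure (P \<theta>' 1)"] Collect_cong conj_cong refl)
      (simp add: in_bad est_eq[OF \<theta>'(1) one] \<theta>'(2) N_def \<tau>_def)
  finally have minus': "\<P>(\<omega> in P \<theta> 1. e < \<bar>T (- t + N (U \<omega>)) (\<tau> (U \<omega>)) - (- t)\<bar>) \<le> 1 / 20"
    using minus by simp
  define G where "G = {\<omega> \<in> space (P \<theta> 1). \<bar>N (U \<omega>)\<bar> \<le> e \<and> \<tau> (U \<omega>) < t}"
  have [measurable]: "G \<in> sets (P \<theta> 1)" unfolding G_def by measurable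
  have good: "9 / 10 \<le> prob G"
  proof -
    let ?E1 = "{\<omega> \<in> space (P \<theta> 1). e < \<bar>est 1 \<omega> - t\<bar>}"
    let ?E2 = "{\<omega> \<in> space (P \<theta> 1). e < \<bar>T (- t + N (U \<omega>)) (\<tau> (U \<omega>)) - (- t)\<bar>}"
    have E: "?E1 \<in> events" "?E2 \<in> events" by measurable
    have "space (P \<theta> 1) - G \<subseteq> ?E1 \<union> ?E2"
    proof (rule subsetI, rule ccontr)
      fix \<omega> assume \<omega>: "\<omega> \<in> space (P \<theta> 1) - G" and no: "\<omega> \<notin> ?E1 \<union> ?E2"
      have "0 \<le> \<tau> (U \<omega>)"
        unfolding \<tau>_def using error_scale_nonneg[of 1 feasible X] feasible xi_pos h by (simp add: dim_X)
      moreover have "\<bar>T (t + N (U \<omega>)) (\<tau> (U \<omega>)) - t\<bar> \<le> e"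
        using \<omega> no est_eq[OF \<theta>(1) one, of \<omega>] \<theta>(2) by (simp add: N_def \<tau>_def U_def)
      moreover have "\<bar>T (- t + N (U \<omega>)) (\<tau> (U \<omega>)) - (- t)\<bar> \<le> e"
        using \<omega> no by simp
      ultimately show False
        using two_sided_accuracy[OF T _ \<open>e < t\<close>] \<omega> by (auto simp: G_def)
    qed
    then have "prob (space (P \<theta> 1) - G) \<le> prob (?E1 \<union> ?E2)"
      using E by (intro finite_measure_mono sets.Un)
    also have "\<dots> \<le> prob ?E1 + prob ?E2" using E by (intro measure_Un_le)
    also have "\<dots> \<le> 1 / 10" using plus minus' by simp
    finally show ?thesis by (simp add: prob_compl)
  qed
  have s: "0 < xi X i / sqrt (real n)" using xi_pos n by simp
  have normal: "distributed (P \<theta> 1) lborel (\<lambda>\<omega>. N (U \<omega>)) (normal_density 0 (xi X i / sqrt (real n)))"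
    using indep_normal_linear_combination[OF errors(2,3)[OF \<theta>(1) one] one, of "\<lambda>r. ls_mat X $$ (i, r)"]
      s xi_pos ls_row_nonzero[OF X_carrier X_rank i]
    by (simp add: ls_row_squares N_def U_def noise_def dim_X)
  have "9 / 10 \<le> prob G" by (rule good)
  also have "\<dots> \<le> \<P>(\<omega> in P \<theta> 1. \<bar>N (U \<omega>)\<bar> \<le> e)"
    by (intro finite_measure_mono) (auto simp: G_def)
  also have "\<dots> \<le> e / (xi X i / sqrt (real n))"
    using normal_concentration_le[OF s normal] \<open>0 < e\<close> by simp
  finally have "9 / 10 * (xi X i / sqrt (real n)) \<le> e" using s by (simp only: pos_le_divide_eq)
  then have "xi X i / sqrt (real n) \<le> 2 * e" using s by linarith
  moreover have "xi X i * h \<le> 2 * t"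
  proof (rule ccontr)
    assume large: "\<not> xi X i * h \<le> 2 * t"
    let ?H = "{\<omega> \<in> space (P \<theta> 1). 1 / 2 \<le> error_scale feasible X 1 (U \<omega>)}"
    have "G \<inter> ?H = {}"
    proof -
      have "t \<le> \<tau> (U \<omega>)" if "1 / 2 \<le> error_scale feasible X 1 (U \<omega>)" for \<omega>
      proof -
        have "1 / 2 * (2 * t) \<le> \<tau> (U \<omega>)"
          unfolding \<tau>_def using that large \<open>0 < e\<close> \<open>e < t\<close> by (intro mult_mono[of _ _ "2 * t"]) auto
        then show ?thesis by simp
      qed
      then show ?thesis by (force simp: G_def)
    qed
    then have "prob G + prob ?H = prob (G \<union> ?H)"
      by (intro finite_measure_Union[symmetric]) auto
    also have "\<dots> \<le> 1" by simp
    finally show False using good error_scale_lower_bound[OF \<theta>(1)] by (simp add: U_def)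
  qed
  ultimately show ?thesis ..
qed

end

section \<open>Suprema over the parameters\<close>

lemma prob_le_sup_prob:
  assumes P: "\<And>\<theta> \<sigma>. \<theta> \<in> carrier_vec k \<Longrightarrow> 0 < \<sigma> \<Longrightarrow> prob_space (P \<theta> \<sigma>)"
    and "\<theta> \<in> carrier_vec k" "0 < \<sigma>"
  shows "\<P>(\<omega> in P \<theta> \<sigma>. c * \<bar>est \<sigma> \<omega> - \<theta> $ i\<bar> > \<sigma> * B) \<le> sup_prob P k i est c B"
proof -
  define p where "p \<theta> \<sigma> = \<P>(\<omega> in P \<theta> \<sigma>. c * \<bar>est \<sigma> \<omega> - \<theta> $ i\<bar> > \<sigma> * B)" for \<theta> \<sigma>
  have p: "p \<theta> \<sigma> \<le> 1" if "\<theta> \<in> carrier_vec k" "0 < \<sigma>" for \<theta> \<sigma>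
    unfolding p_def by (rule prob_space.prob_le_1[OF P[OF that]])
  then have inner: "bdd_above (p \<theta> ` {0<..})" if "\<theta> \<in> carrier_vec k" for \<theta>
    using that by (intro bdd_aboveI[of _ 1]) auto
  have "bdd_above ((\<lambda>\<theta>. SUP \<sigma>\<in>{0<..}. p \<theta> \<sigma>) ` carrier_vec k)"
    using p by (intro bdd_aboveI[of _ 1]) (auto intro!: cSUP_least)
  then have "p \<theta> \<sigma> \<le> (SUP \<theta>\<in>carrier_vec k. SUP \<sigma>\<in>{0<..}. p \<theta> \<sigma>)"
    using assms by (intro cSUP_upper2[of _ _ \<theta>] cSUP_upper2[of _ _ \<sigma>] inner) auto
  then show ?thesis unfolding sup_prob_def p_def .
qed

lemma sup_prob_le:
  assumes "\<And>\<theta> \<sigma>. \<theta> \<in> carrier_vec k \<Longrightarrow> 0 < \<sigma> \<Longrightarrow>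
    \<P>(\<omega> in P \<theta> \<sigma>. c * \<bar>est \<sigma> \<omega> - \<theta> $ i\<bar> > \<sigma> * B) \<le> q"
  shows "sup_prob P k i est c B \<le> q"
  unfolding sup_prob_def
proof (intro cSUP_least)
  show "carrier_vec k \<noteq> ({} :: real vec set)" using zero_carrier_vec[of k] by blast
qed (use assms in auto)

lemma sup_prob_nonneg:
  assumes "\<And>\<theta> \<sigma>. \<theta> \<in> carrier_vec k \<Longrightarrow> 0 < \<sigma> \<Longrightarrow> prob_space (P \<theta> \<sigma>)"
  shows "0 \<le> sup_prob P k i est c B"
proof (rule order_trans[OF measure_nonneg])
  show "\<P>(\<omega> in P (0\<^sub>v k) 1. c * \<bar>est 1 \<omega> - 0\<^sub>v k $ i\<bar> > 1 * B) \<le> sup_prob P k i est c B"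
    by (rule prob_le_sup_prob[OF assms]) auto
qed

section \<open>Consistency and uniform rates\<close>

theorem theorem16:
  fixes k :: "nat \<Rightarrow> nat"
    and X :: "nat \<Rightarrow> real mat"
    and Y :: "nat \<Rightarrow> 'a \<Rightarrow> real vec"
    and P :: "nat \<Rightarrow> real vec \<Rightarrow> real \<Rightarrow> 'a measure"
    and \<eta> :: "nat \<Rightarrow> nat \<Rightarrow> real"
    and i :: nat
    and T :: "real \<Rightarrow> real \<Rightarrow> real"
    and N :: "nat set"
    and est :: "nat \<Rightarrow> real \<Rightarrow> 'a \<Rightarrow> real"
  assumes model: "\<forall>n\<ge>1. gaussian_regression n (k n) (X n) (Y n) (P n)"
    and eta_pos: "\<forall>n\<ge>1. \<forall>j<k n. 0 < \<eta> j n"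
    and xi_bounded: "\<forall>j. (\<forall>\<^sub>F n in sequentially. j < k n) \<longrightarrow>
          bdd_above ((\<lambda>n. (xi (X n) j)\<^sup>2 / real n) ` {n. 1 \<le> n \<and> j < k n})"
    and index: "\<forall>\<^sub>F n in sequentially. i < k n"
    and rule: "T \<in> {hard_thr, soft_thr, adaptive_soft_thr}"
    and estimator:
      "(\<forall>\<^sub>F n in sequentially. k n < n) \<and> N = {n. 1 \<le> n \<and> i < k n \<and> k n < n} \<and>
         est = (\<lambda>n \<sigma> \<omega>. feasible_est T (X n) i (\<eta> i n) \<sigma> (Y n \<omega>))
       \<or> N = {n. 1 \<le> n \<and> i < k n} \<and>
         est = (\<lambda>n \<sigma> \<omega>. infeasible_est T (X n) i (\<eta> i n) \<sigma> (Y n \<omega>))"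
  shows
    "let a = (\<lambda>n. rate (X n) i (\<eta> i n));
         C = ((\<lambda>n. xi (X n) i * \<eta> i n) \<longlonglongrightarrow> 0 \<and> (\<lambda>n. xi (X n) i / sqrt (real n)) \<longlonglongrightarrow> 0)
     in
       (consistent P k i est \<longleftrightarrow> C) \<and>
       (C \<longrightarrow>
         (\<forall>\<epsilon>>0. (\<lambda>n. sup_prob (P n) (k n) i (est n) 1 \<epsilon>) \<longlonglongrightarrow> 0) \<and>
         (\<forall>\<epsilon>>0. \<exists>M>0. (SUP n\<in>N. sup_prob (P n) (k n) i (est n) (a n) M) < \<epsilon>)) \<and>
       (C \<longrightarrow>
         (\<forall>b. (\<forall>n. 0 \<le> b n) \<longrightarrow>
            (\<forall>\<epsilon>>0. \<exists>M>0.
               limsup (\<lambda>n. ereal (sup_prob (P n) (k n) i (est n) (b n) M)) < ereal \<epsilon>) \<longrightarrow>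
            b \<in> O(a)))"
proof -
  define s where "s n = xi (X n) i / sqrt (real n)" for n
  define v where "v n = xi (X n) i * \<eta> i n" for n
  define a where "a n = rate (X n) i (\<eta> i n)" for n
  obtain feasible where
    est: "\<And>n \<sigma> \<omega>. est n \<sigma> \<omega> = (if feasible then feasible_est T (X n) i (\<eta> i n) \<sigma> (Y n \<omega>)
      else infeasible_est T (X n) i (\<eta> i n) \<sigma> (Y n \<omega>))"
    and N: "N = {n. 1 \<le> n \<and> i < k n \<and> (feasible \<longrightarrow> k n < n)}" and ev_feasible: "\<forall>\<^sub>F n in sequentially. feasible \<longrightarrow> k n < n"
    using estimator
  proof (elim disjE conjE)
    assume "\<forall>\<^sub>F n in sequentially. k n < n" "N = {n. 1 \<le> n \<and> i < k n \<and> k n < n}"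
      "est = (\<lambda>n \<sigma> \<omega>. feasible_est T (X n) i (\<eta> i n) \<sigma> (Y n \<omega>))"
    then show thesis by (intro that[of True]) auto
  next
    assume "N = {n. 1 \<le> n \<and> i < k n}"
      "est = (\<lambda>n \<sigma> \<omega>. infeasible_est T (X n) i (\<eta> i n) \<sigma> (Y n \<omega>))"
    then show thesis by (intro that[of False]) auto
  qed
  have ev_N: "\<forall>\<^sub>F n in sequentially. n \<in> N"
    using index ev_feasible eventually_ge_at_top[of 1] by eventually_elim (auto simp: N)
  have at_n: "thresholding_estimator n (k n) (X n) (Y n) (P n) i T (\<eta> i n) feasible (est n)" if "n \<in> N" for n
  proof unfold_locales
    show "gaussian_regression n (k n) (X n) (Y n) (P n)" "1 \<le> n" "i < k n" "0 < \<eta> i n" "feasible \<Longrightarrow> k n < n"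
      using that model eta_pos by (auto simp: N)
  qed (rule rule est)+
  note design_at = thresholding_estimator.axioms(1)[OF at_n]
  have index_at: "i < k n" if "n \<in> N" for n using that by (simp add: N)
  have prob: "prob_space (P n \<theta> \<sigma>)" if "n \<in> N" "\<theta> \<in> carrier_vec (k n)" "0 < \<sigma>" for n \<theta> \<sigma>
    by (rule gaussian_design.errors(1)[OF design_at[OF that(1)] that(2,3)])
  have upper: "\<P>(\<omega> in P n \<theta> \<sigma>. c * \<bar>est n \<sigma> \<omega> - \<theta> $ i\<bar> > \<sigma> * B) \<le> 2 * c\<^sup>2 * ((s n)\<^sup>2 + (v n)\<^sup>2) / B\<^sup>2"
    if "n \<in> N" "\<theta> \<in> carrier_vec (k n)" "0 < \<sigma>" "0 \<le> c" "0 < B" for n \<theta> \<sigma> c B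
    unfolding s_def v_def
    by (rule thresholding_estimator.error_tail_bound[OF at_n[OF that(1)] that(2-5)])
  have lower: "s n \<le> 2 * e \<and> v n \<le> 2 * t"
    if "n \<in> N" "\<theta> \<in> carrier_vec (k n)" "\<theta> $ i = t" "\<theta>' \<in> carrier_vec (k n)" "\<theta>' $ i = - t" "0 < e" "e < t"
      "\<P>(\<omega> in P n \<theta> 1. e < \<bar>est n 1 \<omega> - t\<bar>) \<le> 1 / 20"
      "\<P>(\<omega> in P n \<theta>' 1. e < \<bar>est n 1 \<omega> - (- t)\<bar>) \<le> 1 / 20" for n \<theta> \<theta>' t e
    unfolding s_def v_def
    by (rule thresholding_estimator.accuracy_bounds_scales[OF at_n[OF that(1)] that(2-9)])
  have pos: "0 < s n" "0 < v n" if "n \<in> N" for n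
    using gaussian_design.xi_pos[OF design_at[OF that]] that eta_pos by (simp_all add: s_def v_def N)
  have a_eq: "a n = min (1 / s n) (1 / v n)" if "n \<in> N" for n
    using gaussian_design.dim_X[OF design_at[OF that]] by (simp add: a_def rate_def s_def v_def)
  have square_sum_tendsto: "(\<lambda>n. 2 * c\<^sup>2 * ((s n)\<^sup>2 + (v n)\<^sup>2) / B\<^sup>2) \<longlonglongrightarrow> 0"
    if "s \<longlonglongrightarrow> 0" "v \<longlonglongrightarrow> 0" "0 < B" for c B
    using that by (auto intro!: tendsto_eq_intros)

  have sufficient: "consistent P k i est" if C: "v \<longlonglongrightarrow> 0" "s \<longlonglongrightarrow> 0"
    unfolding consistent_def
  proof (intro allI impI)
    fix t \<sigma> :: real and \<theta> and \<epsilon> :: real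
    assume \<sigma>: "0 < \<sigma>" and \<theta>: "\<forall>n. \<theta> n \<in> carrier_vec (k n) \<and> (i < k n \<longrightarrow> \<theta> n $ i = t)" and \<epsilon>: "0 < \<epsilon>"
    have bound: "\<forall>\<^sub>F n in sequentially. \<P>(\<omega> in P n (\<theta> n) \<sigma>. \<epsilon> < \<bar>est n \<sigma> \<omega> - t\<bar>)
        \<le> 2 * 1\<^sup>2 * ((s n)\<^sup>2 + (v n)\<^sup>2) / (\<epsilon> / \<sigma>)\<^sup>2"
      using ev_N
    proof eventually_elim
      case (elim n)
      have \<theta>n: "\<theta> n \<in> carrier_vec (k n)" "\<theta> n $ i = t" using \<theta> index_at[OF elim] by auto
      have "\<P>(\<omega> in P n (\<theta> n) \<sigma>. 1 * \<bar>est n \<sigma> \<omega> - \<theta> n $ i\<bar> > \<sigma> * (\<epsilon> / \<sigma>))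
          \<le> 2 * 1\<^sup>2 * ((s n)\<^sup>2 + (v n)\<^sup>2) / (\<epsilon> / \<sigma>)\<^sup>2"
        using \<sigma> \<epsilon> by (intro upper elim \<theta>n) auto
      then show ?case using \<sigma> by (simp only: \<theta>n) simp
    qed
    show "(\<lambda>n. \<P>(\<omega> in P n (\<theta> n) \<sigma>. \<epsilon> < \<bar>est n \<sigma> \<omega> - t\<bar>)) \<longlonglongrightarrow> 0"
    proof (rule tendsto_sandwich[OF _ bound tendsto_const])
      show "(\<lambda>n. 2 * 1\<^sup>2 * ((s n)\<^sup>2 + (v n)\<^sup>2) / (\<epsilon> / \<sigma>)\<^sup>2) \<longlonglongrightarrow> 0"
        using C \<sigma> \<epsilon> by (intro square_sum_tendsto) auto
    qed simp
  qed

  have necessary: "v \<longlonglongrightarrow> 0 \<and> s \<longlonglongrightarrow> 0" if cons: "consistent P k i est"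
  proof -
    have small: "\<forall>\<^sub>F n in sequentially. 0 < s n \<and> s n \<le> \<delta> \<and> 0 < v n \<and> v n \<le> 2 * \<delta>" if "0 < \<delta>" for \<delta>
    proof -
      have "\<forall>\<^sub>F n in sequentially. \<P>(\<omega> in P n (vec (k n) (\<lambda>_. t)) 1. \<delta> / 2 < \<bar>est n 1 \<omega> - t\<bar>) < 1 / 20" for t
      proof (rule order_tendstoD(2))
        show "(\<lambda>n. \<P>(\<omega> in P n (vec (k n) (\<lambda>_. t)) 1. \<delta> / 2 < \<bar>est n 1 \<omega> - t\<bar>)) \<longlonglongrightarrow> 0"
          by (rule cons[unfolded consistent_def, rule_format]) (use \<open>0 < \<delta>\<close> in auto)
      qed simp
      \<comment> \<open>The lower estimate with \<open>t = \<delta>\<close> and \<open>e = \<delta> / 2\<close>.\<close>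
      from this[of \<delta>] this[of "- \<delta>"] ev_N show ?thesis
      proof eventually_elim
        case (elim n)
        have "s n \<le> 2 * (\<delta> / 2) \<and> v n \<le> 2 * \<delta>"
          using elim(1,2) index_at[OF elim(3)] \<open>0 < \<delta>\<close>
          by (intro lower[OF elim(3), of "vec (k n) (\<lambda>_. \<delta>)" _ "vec (k n) (\<lambda>_. - \<delta>)"]) auto
        then show ?case using pos[OF elim(3)] by simp
      qed
    qed
    have "s \<longlonglongrightarrow> 0"
    proof (rule tendstoI)
      fix r :: real assume "0 < r"
      then show "\<forall>\<^sub>F n in sequentially. dist (s n) 0 < r"
        using small[of "r / 3"] by (auto elim!: eventually_mono)
    qed
    moreover have "v \<longlonglongrightarrow> 0"
    proof (rule tendstoI)
      fix r :: real assume "0 < r"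
      then show "\<forall>\<^sub>F n in sequentially. dist (v n) 0 < r"
        using small[of "r / 3"] by (auto elim!: eventually_mono)
    qed
    ultimately show ?thesis by simp
  qed

  have uniform: "(\<lambda>n. sup_prob (P n) (k n) i (est n) 1 \<epsilon>) \<longlonglongrightarrow> 0"
    if C: "v \<longlonglongrightarrow> 0" "s \<longlonglongrightarrow> 0" and "0 < \<epsilon>" for \<epsilon>
  proof (rule tendsto_sandwich[OF _ _ tendsto_const square_sum_tendsto[OF C(2,1) \<open>0 < \<epsilon>\<close>, of 1]])
    show "\<forall>\<^sub>F n in sequentially. 0 \<le> sup_prob (P n) (k n) i (est n) 1 \<epsilon>"
      using ev_N by eventually_elim (intro sup_prob_nonneg prob)
    show "\<forall>\<^sub>F n in sequentially. sup_prob (P n) (k n) i (est n) 1 \<epsilon> \<le> 2 * 1\<^sup>2 * ((s n)\<^sup>2 + (v n)\<^sup>2) / \<epsilon>\<^sup>2"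
      using ev_N by eventually_elim (intro sup_prob_le upper, use \<open>0 < \<epsilon>\<close> in auto)
  qed

  have rate: "\<exists>B>0. (SUP n\<in>N. sup_prob (P n) (k n) i (est n) (a n) B) < \<epsilon>" if "0 < \<epsilon>" for \<epsilon>
  proof (intro exI conjI)
    \<comment> \<open>Since \<open>a s \<le> 1\<close> and \<open>a v \<le> 1\<close>, the tail bound is at most \<open>4 / B\<^sup>2\<close>, which is then \<open>\<epsilon> / 2\<close>.\<close>
    define B where "B = sqrt (8 / \<epsilon>)"
    show B: "0 < B" using that by (simp add: B_def)
    have "sup_prob (P n) (k n) i (est n) (a n) B \<le> \<epsilon> / 2" if n: "n \<in> N" for n
    proof (rule sup_prob_le)
      fix \<theta> :: "real vec" and \<sigma> :: real assume \<theta>: "\<theta> \<in> carrier_vec (k n)" "0 < \<sigma>"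
      have a0: "0 \<le> a n" using pos[OF n] by (simp add: a_eq[OF n])
      have "a n * s n \<le> 1" "a n * v n \<le> 1"
        using pos[OF n] by (simp_all add: a_eq[OF n] min_def field_simps)
      then have "(a n * s n)\<^sup>2 \<le> 1" "(a n * v n)\<^sup>2 \<le> 1"
        using pos[OF n] a0 by (auto intro!: power_le_one)
      then have "2 * (a n)\<^sup>2 * ((s n)\<^sup>2 + (v n)\<^sup>2) / B\<^sup>2 \<le> 4 / B\<^sup>2"
        by (intro divide_right_mono) (auto simp: power_mult_distrib distrib_left)
      also have "\<dots> = \<epsilon> / 2" using \<open>0 < \<epsilon>\<close> by (simp add: B_def)
      finally show "\<P>(\<omega> in P n \<theta> \<sigma>. a n * \<bar>est n \<sigma> \<omega> - \<theta> $ i\<bar> > \<sigma> * B) \<le> \<epsilon> / 2"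
        using upper[OF n \<theta> a0 B] by simp
    qed
    moreover have "N \<noteq> {}" using eventually_happens[OF ev_N] by auto
    ultimately have "(SUP n\<in>N. sup_prob (P n) (k n) i (est n) (a n) B) \<le> \<epsilon> / 2"
      by (intro cSUP_least)
    then show "(SUP n\<in>N. sup_prob (P n) (k n) i (est n) (a n) B) < \<epsilon>" using that by simp
  qed

  have optimal: "b \<in> O(a)" if b: "\<forall>n. 0 \<le> b n"
    and tight: "\<forall>\<epsilon>>0. \<exists>B>0. limsup (\<lambda>n. ereal (sup_prob (P n) (k n) i (est n) (b n) B)) < ereal \<epsilon>" for b
  proof -
    obtain B where B: "0 < B" and limsup: "limsup (\<lambda>n. ereal (sup_prob (P n) (k n) i (est n) (b n) B)) < ereal (1 / 20)"
      using tight[rule_format, of "1 / 20"] by auto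
    have "\<forall>\<^sub>F n in sequentially. norm (b n) \<le> 4 * B * norm (a n)"
      using Limsup_lessD[OF limsup] ev_N
    proof eventually_elim
      case (elim n)
      note n = elim(2)
      have a0: "0 < a n" using pos[OF n] by (simp add: a_eq[OF n])
      show ?case
      proof (cases "b n = 0")
        case True
        then show ?thesis using a0 B by simp
      next
        case False
        then have bn: "0 < b n" using b by (simp add: less_le)
        have small: "\<P>(\<omega> in P n (vec (k n) (\<lambda>_. t)) 1. B / b n < \<bar>est n 1 \<omega> - t\<bar>) \<le> 1 / 20" for t
        proof -
          have "\<P>(\<omega> in P n (vec (k n) (\<lambda>_. t)) 1. b n * \<bar>est n 1 \<omega> - vec (k n) (\<lambda>_. t) $ i\<bar> > 1 * B)
              \<le> sup_prob (P n) (k n) i (est n) (b n) B"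
            by (rule prob_le_sup_prob[OF prob[OF n]]) auto
          also have "\<dots> \<le> 1 / 20" using elim(1) by simp
          finally show ?thesis using bn index_at[OF n] by (simp add: pos_divide_less_eq mult.commute)
        qed
        \<comment> \<open>The lower estimate with \<open>t = 2 B / b\<close> and \<open>e = B / b\<close>.\<close>
        have "s n \<le> 2 * (B / b n) \<and> v n \<le> 2 * (2 * B / b n)"
          using small[of "2 * B / b n"] small[of "- (2 * B / b n)"] index_at[OF n] B bn
          by (intro lower[OF n, of "vec (k n) (\<lambda>_. 2 * B / b n)" _ "vec (k n) (\<lambda>_. - (2 * B / b n))"])
            (auto simp: divide_strict_right_mono)
        then have "b n \<le> 4 * B * (1 / s n)" "b n \<le> 4 * B * (1 / v n)"
          using pos[OF n] bn B by (auto simp: field_simps)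
        then have "b n \<le> 4 * B * a n" by (auto simp: a_eq[OF n] min_def)
        then show ?thesis using bn a0 by simp
      qed
    qed
    then show ?thesis by (rule bigoI)
  qed

  show ?thesis
    unfolding Let_def s_def[symmetric] v_def[symmetric] a_def[symmetric]
  proof (intro conjI impI iffI)
    show "v \<longlonglongrightarrow> 0" "s \<longlonglongrightarrow> 0" if "consistent P k i est" using necessary[OF that] by auto
    show "consistent P k i est" if "v \<longlonglongrightarrow> 0 \<and> s \<longlonglongrightarrow> 0" using sufficient that by simp
    show "\<forall>\<epsilon>>0. (\<lambda>n. sup_prob (P n) (k n) i (est n) 1 \<epsilon>) \<longlonglongrightarrow> 0" if "v \<longlonglongrightarrow> 0 \<and> s \<longlonglongrightarrow> 0"
      using uniform that by simp
    show "\<forall>\<epsilon>>0. \<exists>B>0. (SUP n\<in>N. sup_prob (P n) (k n) i (est n) (a n) B) < \<epsilon>" using rate by simp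
    show "\<forall>b. (\<forall>n. 0 \<le> b n) \<longrightarrow>
        (\<forall>\<epsilon>>0. \<exists>B>0. limsup (\<lambda>n. ereal (sup_prob (P n) (k n) i (est n) (b n) B)) < ereal \<epsilon>) \<longrightarrow> b \<in> O(a)"
      using optimal by blast
  qed
qed

end
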